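(* Let $F\subset\mathbb{R}^2_{\geq}$ be a convex polygon (quadrilateral) with vertices $P_1,P_2,P_3,P_4\in\mathbb{Q}_{\geq}^2$, and let $\mathcal{P}=\bigcup_{i=0}^{\infty}(iF)\cap\mathbb{N}^2$ be its associated affine convex polygonal semigroup. Let $\tau_1,\tau_2$ be the extremal rays of the cone $L_{\mathbb{Q}_{\geq}}(F)\cap\mathbb{N}^2$. If $P_1\in\mathcal{P}\cap\tau_1$, $P_4\in\mathcal{P}\cap\tau_2$ and the points $O$ (the origin), $P_2$ and $P_3$ are aligned, then $\mathcal{P}$ is Buchsbaum.
   Context: Here $\mathbb{N}$ contains $0$, $\mathbb{R}^2_{\geq}$ is the set of points with nonnegative coordinates, and a convex polygon means the full convex hull of its vertices, with $iF=\{ix\mid x\in F\}$. The labelling $P_1,\ldots,P_4$ of the four vertices is not assumed to be in cyclic order. For $G\subset\mathbb{R}^2_{\geq}$, $L_{\mathbb{Q}_{\geq}}(G)=\{\sum_{i=1}^p q_if_i \mid p\in\mathbb{N},\ q_i\in\mathbb{Q}_{\geq},\ f_i\in G\}$. The extremal rays $\tau_1,\tau_2$ are the two half-lines from the origin bounding this cone, $\tau_1$ being the one with greater slope. An affine semigroup is a finitely generated submonoid of $\mathbb{N}^2$. Let $\Bbbk$ be a field. The semigroup ring $\Bbbk[S]$ of an affine semigroup $S\subset\mathbb{N}^2$ is the subring of $\Bbbk[t_1,t_2]$ generated by the monomials $t_1^{s_1}t_2^{s_2}$ with $(s_1,s_2)\in S$; $S$ is called Buchsbaum if $\Bbbk[S]$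 is a Buchsbaum ring. *)

theory Defs
  imports
    "HOL-Analysis.Analysis"
    "HOL-Algebra.Algebra"
    "HOL-Algebra.Algebraic_Closure_Type"
    "HOL-Library.Poly_Mapping"
    "HOL-Library.Extended_Nat"
begin

section \<open>Affine convex polygonal semigroups\<close>

definition nonneg_rat_points :: "(real \<times> real) set"
  where "nonneg_rat_points = {(x, y). x \<in> \<rat> \<and> y \<in> \<rat> \<and> 0 \<le> x \<and> 0 \<le> y}"

text \<open>Requiring every point of \<open>V\<close> to be extreme makes the elements of \<open>V\<close> genuine vertices;
  with at least three of them the polygon has nonempty interior.\<close>

definition convex_polygon_with_vertices :: "(real \<times> real) set \<Rightarrow> (real \<times> real) set \<Rightarrow> bool"
  where "convex_polygon_with_vertices F V \<longleftrightarrow>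
    finite V \<and> 3 \<le> card V \<and> F = convex hull V \<and> {x. x extreme_point_of F} = V"

definition real_point :: "nat \<times> nat \<Rightarrow> real \<times> real"
  where "real_point s = (real (fst s), real (snd s))"

definition polygonal_semigroup :: "(real \<times> real) set \<Rightarrow> (nat \<times> nat) set"
  where "polygonal_semigroup F = {s. real_point s \<in> (\<Union>i::nat. (\<lambda>x. real i *\<^sub>R x) ` F)}"

definition rat_cone :: "(real \<times> real) set \<Rightarrow> (real \<times> real) set"
  where "rat_cone G = {\<Sum>i<p. q i *\<^sub>R f i | (p::nat) (q::nat \<Rightarrow> real) f.
    \<forall>i<p. q i \<in> \<rat> \<and> 0 \<le> q i \<and> f i \<in> G}"

definition half_line :: "real \<times> real \<Rightarrow> (real \<times> real) set"
  where "half_line u = {t *\<^sub>R u | t. 0 \<le> t}"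

text \<open>\<open>C\<close> may be a discrete set of lattice points, so its boundary is taken to be that of the
  real convex cone it spans. For nonzero \<open>u\<close>, \<open>v\<close> in the closed first quadrant, the inequality
  says that the slope of \<open>u\<close> exceeds that of \<open>v\<close>, a vertical direction having infinite slope.\<close>

definition extremal_rays ::
    "(real \<times> real) set \<Rightarrow> (real \<times> real) set \<Rightarrow> (real \<times> real) set \<Rightarrow> bool"
  where "extremal_rays C \<tau>\<^sub>1 \<tau>\<^sub>2 \<longleftrightarrow>
    (\<exists>u v. u \<noteq> 0 \<and> v \<noteq> 0 \<and> \<tau>\<^sub>1 = half_line u \<and> \<tau>\<^sub>2 = half_line v \<and>
      snd v * fst u < snd u * fst v \<and> frontier (convex_cone hull C) = \<tau>\<^sub>1 \<union> \<tau>\<^sub>2)"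

definition affine_semigroup :: "(nat \<times> nat) set \<Rightarrow> bool"
  where "affine_semigroup S \<longleftrightarrow>
    (\<exists>A. finite A \<and> S = (\<lambda>M. 0 \<in> M \<and> (\<forall>x\<in>M. \<forall>y\<in>M. x + y \<in> M)) hull A)"


section \<open>Localization\<close>

text \<open>The class of \<open>a / s\<close> in the localization of \<open>R\<close> at a multiplicative set \<open>T\<close>;
  the factor \<open>u\<close> is needed when \<open>R\<close> has zero divisors.\<close>

definition fraction :: "('a, 'b) ring_scheme \<Rightarrow> 'a set \<Rightarrow> 'a \<Rightarrow> 'a \<Rightarrow> ('a \<times> 'a) set"
  where "fraction R T a s =
    {(b, t). b \<in> carrier R \<and> t \<in> T \<and>
      (\<exists>u\<in>T. u \<otimes>\<^bsub>R\<^esub> (a \<otimes>\<^bsub>R\<^esub> t) = u \<otimes>\<^bsub>R\<^esub> (b \<otimes>\<^bsub>R\<^esub> s))}"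

text \<open>In the sum and the product of two classes, all the fractions in the union are the same
  class, since the result does not depend on the representatives.\<close>

definition localization :: "('a, 'b) ring_scheme \<Rightarrow> 'a set \<Rightarrow> ('a \<times> 'a) set ring"
  where "localization R T =
    \<lparr>carrier = {fraction R T a s | a s. a \<in> carrier R \<and> s \<in> T},
     monoid.mult = (\<lambda>A B. \<Union>(a, s)\<in>A. \<Union>(b, t)\<in>B. fraction R T (a \<otimes>\<^bsub>R\<^esub> b) (s \<otimes>\<^bsub>R\<^esub> t)),
     one = fraction R T \<one>\<^bsub>R\<^esub> \<one>\<^bsub>R\<^esub>,
     ring.zero = fraction R T \<zero>\<^bsub>R\<^esub> \<one>\<^bsub>R\<^esub>,
     add = (\<lambda>A B. \<Union>(a, s)\<in>A. \<Union>(b, t)\<in>B.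
       fraction R T (a \<otimes>\<^bsub>R\<^esub> t \<oplus>\<^bsub>R\<^esub> b \<otimes>\<^bsub>R\<^esub> s) (s \<otimes>\<^bsub>R\<^esub> t))\<rparr>"


section \<open>Buchsbaum rings\<close>

definition krull_dim :: "('a, 'b) ring_scheme \<Rightarrow> enat"
  where "krull_dim R =
    Sup {enat n | n. \<exists>p. (\<forall>i\<le>n. primeideal (p i) R) \<and> (\<forall>i<n. p i \<subset> p (Suc i))}"

text \<open>For a local ring \<open>R\<close> with maximal ideal \<open>m\<close>. An ideal whose radical is \<open>m\<close> is
  \<open>m\<close>-primary.\<close>

definition system_of_parameters :: "('a, 'b) ring_scheme \<Rightarrow> 'a set \<Rightarrow> 'a list \<Rightarrow> bool"
  where "system_of_parameters R m xs \<longleftrightarrow>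
    set xs \<subseteq> m \<and> krull_dim R = enat (length xs) \<and>
    {y \<in> carrier R. \<exists>n::nat. y [^]\<^bsub>R\<^esub> n \<in> genideal R (set xs)} = m"

text \<open>\<open>m ((x\<^sub>1, \<dots>, x\<^sub>i\<^sub>-\<^sub>1) : x\<^sub>i) \<subseteq> (x\<^sub>1, \<dots>, x\<^sub>i\<^sub>-\<^sub>1)\<close> for all \<open>i\<close>.\<close>

definition weak_sequence :: "('a, 'b) ring_scheme \<Rightarrow> 'a set \<Rightarrow> 'a list \<Rightarrow> bool"
  where "weak_sequence R m xs \<longleftrightarrow>
    (\<forall>i<length xs. \<forall>y\<in>carrier R.
      y \<otimes>\<^bsub>R\<^esub> (xs ! i) \<in> genideal R (set (take i xs)) \<longrightarrow>
      (\<forall>z\<in>m. z \<otimes>\<^bsub>R\<^esub> y \<in> genideal R (set (take i xs))))"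

definition buchsbaum_local_ring :: "('a, 'b) ring_scheme \<Rightarrow> bool"
  where "buchsbaum_local_ring R \<longleftrightarrow>
    cring R \<and> noetherian_ring R \<and>
    (\<exists>m. {I. maximalideal I R} = {m} \<and>
      (\<forall>xs. system_of_parameters R m xs \<longrightarrow> weak_sequence R m xs))"

definition buchsbaum_ring :: "('a, 'b) ring_scheme \<Rightarrow> bool"
  where "buchsbaum_ring R \<longleftrightarrow>
    cring R \<and> noetherian_ring R \<and>
    (\<forall>m. maximalideal m R \<longrightarrow> buchsbaum_local_ring (localization R (carrier R - m)))"


section \<open>Buchsbaum semigroups\<close>

text \<open>The type \<open>(nat \<times> nat) \<Rightarrow>\<^sub>0 'k\<close> with its convolution product is the polynomial ring in two
  variables over \<open>'k\<close>; \<open>Poly_Mapping.single (a, b) c\<close> is the term with coefficient \<open>c\<close> and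
  exponents \<open>a\<close>, \<open>b\<close>. The generators include the constants, so that the result is a
  \<open>'k\<close>-algebra.\<close>

definition semigroup_ring :: "(nat \<times> nat) set \<Rightarrow> ((nat \<times> nat) \<Rightarrow>\<^sub>0 'k::field) ring"
  where "semigroup_ring S = ring_of_type_algebra
    \<lparr>carrier := generate_ring ring_of_type_algebra
       (range (Poly_Mapping.single 0) \<union> (\<lambda>s. Poly_Mapping.single s 1) ` S)\<rparr>"

definition buchsbaum_semigroup :: "'k::field itself \<Rightarrow> (nat \<times> nat) set \<Rightarrow> bool"
  where "buchsbaum_semigroup k S \<longleftrightarrow>
    affine_semigroup S \<and> buchsbaum_ring (semigroup_ring S :: ((nat \<times> nat) \<Rightarrow>\<^sub>0 'k) ring)"

end

theory Submission
  imports Defs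
begin

text \<open>The ring \<open>K[\<P>]\<close> is in fact Cohen-Macaulay. Choose \<open>a\<close>, \<open>b\<close> in \<open>\<P>\<close> on the two extremal rays.
  The line through \<open>O\<close>, \<open>P\<^sub>2\<close>, \<open>P\<^sub>3\<close> cuts \<open>F\<close> into two triangles, each having one of the vertices
  \<open>P\<^sub>1\<close>, \<open>P\<^sub>4\<close> on its extremal ray, so that in either half of the cone \<open>k F\<close> is cut out by two linear
  forms which both increase by \<open>1\<close> when that vertex is added. Hence an integer point \<open>x\<close>
  with \<open>x + i a\<close> and \<open>x + j b\<close> in \<open>\<P>\<close> lies in \<open>\<P>\<close>. If \<open>O \<in> F\<close>, this is clear since
  \<open>\<P>\<close> consists of all the integer points of a cone.

  This criterion makes every pair \<open>u \<in> K[t\<^sup>a]\<close>, \<open>v \<in> K[t\<^sup>b]\<close> of nonzero polynomials a regular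
  sequence in \<open>K[\<P>]\<close>. Counting monomials shows that a chain \<open>0 \<noteq> p \<subset> q\<close> of primes forces \<open>q\<close>
  to contain such \<open>u\<close> and \<open>v\<close>, and then \<open>q\<close> is a maximal prime. So the localizations have
  dimension at most \<open>2\<close>. For a system of parameters \<open>x\<^sub>1, x\<^sub>2\<close>, powers of \<open>u\<close> and \<open>v\<close> lie in
  \<open>(x\<^sub>1, x\<^sub>2)\<close>; if \<open>y x\<^sub>2 \<in> (x\<^sub>1)\<close>, they multiply \<open>y\<close> into \<open>(x\<^sub>1)\<close>, and regularity of the powers of
  \<open>u\<close>, \<open>v\<close> gives \<open>y \<in> (x\<^sub>1)\<close>.\<close>

section \<open>Localizations of subdomains\<close>

text \<open>A maximal ideal of the semigroup ring need not contain \<open>t^a\<close> or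
  \<open>t^b\<close>, and the field need not be algebraically closed. The regular sequences
  therefore consist of arbitrary nonzero polynomials in \<open>t^a\<close> and in
  \<open>t^b\<close>, whose existence inside a prime comes from linear dependence and not from a
  formula. Powers of such polynomials are again of this kind, so the unspecified exponents that a
  radical produces do no harm. The dimension of a localization is never computed. A system of
  parameters has the Krull dimension as its length by definition, so an upper bound suffices, and
  lengths 0 and 1 are settled because the localization is a domain. One tool, division with
  remainder by leading exponents, serves generation by monomials, finite generation of ideals,
  dependence modulo a prime and regularity. The case of the origin in \<open>F\<close> is separate
  because a vertex assumed to lie on an extremal ray may then be the origin itself and determine no
  direction.\<close>

lemma cring_ideal_iff:
  fixes R (structure)
  assumes "cring R"
  shows "ideal I R \<longleftrightarrow> I \<subseteq> carrier R \<and> \<zero> \<in> I \<and> (\<forall>x\<in>I. \<forall>y\<in>I. x \<oplus> y \<in> I) \<and>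
    (\<forall>c\<in>carrier R. \<forall>x\<in>I. c \<otimes> x \<in> I)"
    (is "_ \<longleftrightarrow> ?P")
proof -
  interpret cring R by fact
  show ?thesis
  proof
    assume "ideal I R"
    then interpret I: ideal I R .
    show ?P by (intro conjI ballI subsetI) (simp_all add: I.I_l_closed)
  next
    assume P: ?P
    have neg: "\<ominus> x \<in> I" if "x \<in> I" for x
    proof -
      have x: "x \<in> carrier R" using that P by blast
      have "\<ominus> x = (\<ominus> \<one>) \<otimes> x" using x by (simp add: l_minus)
      then show ?thesis using P that by simp
    qed
    show "ideal I R"
    proof (rule idealI)
      show "ring R" ..
      show "subgroup I (add_monoid R)"
      proof (rule add.subgroupI)
        fix a assume "a \<in> I"
        then show "\<ominus> a \<in> I" by (rule neg)
      qed (use P in auto)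
      show "x \<otimes> a \<in> I" if "a \<in> I" "x \<in> carrier R" for a x using P that by blast
      show "a \<otimes> x \<in> I" if "a \<in> I" "x \<in> carrier R" for a x
        using P that m_comm[of a x] by auto
    qed
  qed
qed

text \<open>The operations are those of the type, so identities in a subring become type-class
  arithmetic as soon as the record layer is simplified away.\<close>

definition subring_of :: "'a::comm_ring_1 set \<Rightarrow> 'a ring"
  where "subring_of C = ring_of_type_algebra\<lparr>carrier := C\<rparr>"

lemma subring_of_simps [simp]:
  "carrier (subring_of C) = C" "x \<otimes>\<^bsub>subring_of C\<^esub> y = x * y" "x \<oplus>\<^bsub>subring_of C\<^esub> y = x + y"
  "\<one>\<^bsub>subring_of C\<^esub> = 1" "\<zero>\<^bsub>subring_of C\<^esub> = 0"
  by (simp_all add: subring_of_def ring_of_type_algebra_def)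

text \<open>The ambient type is only a commutative ring; cancellation is required inside
  \<open>C\<close>. For polynomials in two variables it will come from leading exponents.\<close>

locale subdomain =
  fixes C :: "'a::comm_ring_1 set"
  assumes one_mem: "1 \<in> C"
    and uminus_mem: "\<And>x. x \<in> C \<Longrightarrow> - x \<in> C"
    and add_mem: "\<And>x y. x \<in> C \<Longrightarrow> y \<in> C \<Longrightarrow> x + y \<in> C"
    and mult_mem: "\<And>x y. x \<in> C \<Longrightarrow> y \<in> C \<Longrightarrow> x * y \<in> C"
    and no_zero_div: "\<And>x y. x \<in> C \<Longrightarrow> y \<in> C \<Longrightarrow> x * y = 0 \<Longrightarrow> x = 0 \<or> y = 0"
begin

abbreviation "R \<equiv> subring_of C"

lemma zero_mem: "0 \<in> C"
  using add_mem[OF one_mem uminus_mem[OF one_mem]] by simp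

lemma diff_mem: "x \<in> C \<Longrightarrow> y \<in> C \<Longrightarrow> x - y \<in> C"
  using add_mem[of x "- y"] uminus_mem by simp

lemma power_mem: "x \<in> C \<Longrightarrow> x ^ n \<in> C"
  by (induction n) (auto intro: one_mem mult_mem)

lemmas mem = one_mem zero_mem uminus_mem add_mem mult_mem diff_mem power_mem

lemma cancel:
  assumes "x \<in> C" "y \<in> C" "z \<in> C" "x \<noteq> 0" "x * y = x * z"
  shows "y = z"
  using no_zero_div[of x "y - z"] assms by (auto simp: mem right_diff_distrib)

lemma power_nonzero: "x \<in> C \<Longrightarrow> x \<noteq> 0 \<Longrightarrow> x ^ n \<noteq> 0"
proof (induction n)
  case 0
  have "(1::'a) \<noteq> 0"
    by simp
  then show ?case by simp
next
  case (Suc n)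
  then show ?case using no_zero_div[of x "x ^ n"] by (auto simp: mem)
qed

lemma cring_R: "cring R"
proof (rule cringI)
  show "abelian_group R"
  proof (rule abelian_groupI)
    show "\<exists>y\<in>carrier R. y \<oplus>\<^bsub>R\<^esub> x = \<zero>\<^bsub>R\<^esub>" if "x \<in> carrier R" for x
      using that by (auto intro!: bexI[of _ "- x"] simp: mem)
  qed (auto simp: mem algebra_simps)
  show "Group.comm_monoid R"
    by (rule comm_monoidI) (auto simp: mem algebra_simps)
qed (auto simp: algebra_simps)

lemma ideal_R_iff:
  "ideal I R \<longleftrightarrow> I \<subseteq> C \<and> 0 \<in> I \<and> (\<forall>x\<in>I. \<forall>y\<in>I. x + y \<in> I) \<and> (\<forall>c\<in>C. \<forall>x\<in>I. c * x \<in> I)"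
  using cring_ideal_iff[OF cring_R] by simp

lemma primeideal_R_iff:
  "primeideal p R \<longleftrightarrow>
    ideal p R \<and> p \<noteq> C \<and> (\<forall>a\<in>C. \<forall>b\<in>C. a * b \<in> p \<longrightarrow> a \<in> p \<or> b \<in> p)"
  using cring_R unfolding primeideal_def primeideal_axioms_def by auto

lemma genideal_R_least:
  assumes "ideal I R" "A \<subseteq> I" shows "genideal R A \<subseteq> I"
  using assms by (auto simp: genideal_def)

lemma genideal_R_singleton:
  assumes "a \<in> C" "x \<in> genideal R {a}"
  shows "\<exists>c\<in>C. x = c * a"
proof -
  have "ideal {c * a | c. c \<in> C} R"
    unfolding ideal_R_iff
  proof (intro conjI ballI)
    show "{c * a | c. c \<in> C} \<subseteq> C" using assms by (auto simp: mem)
    show "0 \<in> {c * a | c. c \<in> C}" by (auto intro!: exI[of _ 0] simp: mem)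
    show "x + y \<in> {c * a | c. c \<in> C}"
      if xy: "x \<in> {c * a | c. c \<in> C}" "y \<in> {c * a | c. c \<in> C}" for x y
    proof -
      obtain c d where "c \<in> C" "d \<in> C" "x = c * a" "y = d * a" using xy by blast
      then have "x + y = (c + d) * a" "c + d \<in> C" by (auto simp: mem algebra_simps)
      then show ?thesis by blast
    qed
    show "b * x \<in> {c * a | c. c \<in> C}" if "b \<in> C" "x \<in> {c * a | c. c \<in> C}" for b x
      using that mult_mem by (auto simp: mult.assoc [symmetric])
  qed
  moreover have "{a} \<subseteq> {c * a | c. c \<in> C}" by (auto intro!: exI[of _ 1] simp: mem)
  ultimately show ?thesis using genideal_R_least assms(2) by blast
qed

lemma genideal_R_pair:
  assumes "a \<in> C" "b \<in> C" "x \<in> genideal R {a, b}"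
  shows "\<exists>c\<in>C. \<exists>d\<in>C. x = c * a + d * b"
proof -
  let ?I = "{c * a + d * b | c d. c \<in> C \<and> d \<in> C}"
  have "ideal ?I R"
    unfolding ideal_R_iff
  proof (intro conjI ballI)
    show "?I \<subseteq> C" using assms by (auto simp: mem)
    show "0 \<in> ?I" by (auto intro!: exI[of _ 0] simp: mem)
    show "x + y \<in> ?I" if xy: "x \<in> ?I" "y \<in> ?I" for x y
    proof -
      obtain c d c' d' where "c \<in> C" "d \<in> C" "c' \<in> C" "d' \<in> C"
        "x = c * a + d * b" "y = c' * a + d' * b" using xy by blast
      then have "x + y = (c + c') * a + (d + d') * b" "c + c' \<in> C" "d + d' \<in> C"
        by (auto simp: mem algebra_simps)
      then show ?thesis by blast
    qed
    show "e * x \<in> ?I" if ex: "e \<in> C" "x \<in> ?I" for e x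
    proof -
      obtain c d where "c \<in> C" "d \<in> C" "x = c * a + d * b" using ex by blast
      then have "e * x = (e * c) * a + (e * d) * b" "e * c \<in> C" "e * d \<in> C"
        using ex by (auto simp: mem algebra_simps)
      then show ?thesis by blast
    qed
  qed
  moreover have "{a, b} \<subseteq> ?I"
    using exI[of "\<lambda>c. \<exists>d. a = c * a + d * b \<and> c \<in> C \<and> d \<in> C" 1]
      exI[of "\<lambda>c. \<exists>d. b = c * a + d * b \<and> c \<in> C \<and> d \<in> C" 0]
      exI[of "\<lambda>d. a = 1 * a + d * b \<and> 1 \<in> C \<and> d \<in> C" 0]
      exI[of "\<lambda>d. b = 0 * a + d * b \<and> 0 \<in> C \<and> d \<in> C" 1]
    by (auto simp: mem)
  ultimately show ?thesis using genideal_R_least assms(3) by blast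
qed

end

section \<open>Localization of a domain at a multiplicative set\<close>

locale localized_subdomain = subdomain +
  fixes T :: "'a set"
  assumes T_sub: "T \<subseteq> C" and T_one: "1 \<in> T" and T_zero: "0 \<notin> T"
    and T_mult: "\<And>x y. x \<in> T \<Longrightarrow> y \<in> T \<Longrightarrow> x * y \<in> T"
begin

abbreviation "fr \<equiv> fraction R T"
abbreviation "L \<equiv> localization R T"

lemma T_C: "s \<in> T \<Longrightarrow> s \<in> C" using T_sub by blast

lemma T_nonzero: "s \<in> T \<Longrightarrow> s \<noteq> 0" using T_zero by blast

text \<open>Elements of \<open>T\<close> are nonzero, so the factor \<open>u\<close> in
  \<open>fraction\<close> cancels; conversely \<open>u = 1\<close> is a witness.\<close>

lemma mem_fr:
  assumes "a \<in> C" "s \<in> T"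
  shows "(b, t) \<in> fr a s \<longleftrightarrow> b \<in> C \<and> t \<in> T \<and> a * t = b * s"
proof -
  have "a * t = b * s" if "b \<in> C" "t \<in> T" "u \<in> T" "u * (a * t) = u * (b * s)" for u
    using cancel[of u "a * t" "b * s"] that assms by (auto simp: mem T_C T_nonzero)
  then show ?thesis unfolding fraction_def using T_one by auto
qed

lemma fr_eq:
  assumes "a \<in> C" "s \<in> T" "b \<in> C" "t \<in> T"
  shows "fr a s = fr b t \<longleftrightarrow> a * t = b * s"
proof
  assume "fr a s = fr b t"
  moreover have "(a, s) \<in> fr a s" using assms by (simp add: mem_fr)
  ultimately show "a * t = b * s" using assms by (simp add: mem_fr)
next
  have sub: "fr a s \<subseteq> fr b t"
    if h: "a * t = b * s" "a \<in> C" "s \<in> T" "b \<in> C" "t \<in> T" for a s b t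
  proof (rule subrelI)
    fix c r assume "(c, r) \<in> fr a s"
    then have c: "c \<in> C" "r \<in> T" "a * r = c * s" using h by (auto simp: mem_fr)
    have "s * (b * r) = r * (a * t)" using h(1) by (simp add: ac_simps)
    also have "\<dots> = s * (c * t)" using c(3) by (metis mult.assoc mult.commute)
    finally have "b * r = c * t"
      using cancel[of s "b * r" "c * t"] h c by (auto simp: mem T_C T_nonzero)
    then show "(c, r) \<in> fr b t" using h c by (simp add: mem_fr)
  qed
  assume "a * t = b * s"
  then show "fr a s = fr b t" using sub[of a t b s] sub[of b s a t] assms by auto
qed

lemma carrier_L: "carrier L = {fr a s | a s. a \<in> C \<and> s \<in> T}"
  by (simp add: localization_def)

lemma fr_mem: "a \<in> C \<Longrightarrow> s \<in> T \<Longrightarrow> fr a s \<in> carrier L"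
  by (auto simp: carrier_L)

lemma L_cases:
  assumes "x \<in> carrier L"
  obtains a s where "a \<in> C" "s \<in> T" "x = fr a s"
  using assms by (auto simp: carrier_L)

lemma L_one: "\<one>\<^bsub>L\<^esub> = fr 1 1" and L_zero: "\<zero>\<^bsub>L\<^esub> = fr 0 1"
  by (simp_all add: localization_def)

text \<open>Sum and product in \<open>localization\<close> are unions over all representatives.
  Classes are nonempty, so independence of the representatives collapses such a union to a single
  class.\<close>

lemma union_fractions:
  assumes "a \<in> C" "s \<in> T" "b \<in> C" "t \<in> T"
    and "\<And>a' s' b' t'. (a', s') \<in> fr a s \<Longrightarrow> (b', t') \<in> fr b t \<Longrightarrow> h a' s' b' t' = q"
  shows "(\<Union>(a', s')\<in>fr a s. \<Union>(b', t')\<in>fr b t. h a' s' b' t') = q"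
proof -
  have "(a, s) \<in> fr a s" "(b, t) \<in> fr b t" using assms by (simp_all add: mem_fr)
  then show ?thesis using assms(5) by fast
qed

lemma L_mult:
  assumes "a \<in> C" "s \<in> T" "b \<in> C" "t \<in> T"
  shows "fr a s \<otimes>\<^bsub>L\<^esub> fr b t = fr (a * b) (s * t)"
proof -
  have "fr (a' * b') (s' * t') = fr (a * b) (s * t)"
    if "(a', s') \<in> fr a s" "(b', t') \<in> fr b t" for a' s' b' t'
  proof -
    have h: "a' \<in> C" "s' \<in> T" "a * s' = a' * s" "b' \<in> C" "t' \<in> T" "b * t' = b' * t"
      using that assms by (auto simp: mem_fr)
    have "(a' * s) * (b' * t) = (a * s') * (b * t')" using h by simp
    then have "(a' * b') * (s * t) = (a * b) * (s' * t')" by (simp add: ac_simps)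
    then show ?thesis using h assms by (subst fr_eq) (auto simp: mem T_mult)
  qed
  then have "(\<Union>(a', s')\<in>fr a s. \<Union>(b', t')\<in>fr b t. fr (a' * b') (s' * t')) = fr (a * b) (s * t)"
    by (rule union_fractions[OF assms])
  then show ?thesis by (simp add: localization_def)
qed

lemma L_add:
  assumes "a \<in> C" "s \<in> T" "b \<in> C" "t \<in> T"
  shows "fr a s \<oplus>\<^bsub>L\<^esub> fr b t = fr (a * t + b * s) (s * t)"
proof -
  have "fr (a' * t' + b' * s') (s' * t') = fr (a * t + b * s) (s * t)"
    if "(a', s') \<in> fr a s" "(b', t') \<in> fr b t" for a' s' b' t'
  proof -
    have h: "a' \<in> C" "s' \<in> T" "a * s' = a' * s" "b' \<in> C" "t' \<in> T" "b * t' = b' * t"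
      using that assms by (auto simp: mem_fr)
    have "(a' * t' + b' * s') * (s * t) = (a' * s) * (t * t') + (b' * t) * (s * s')"
      by (simp add: algebra_simps)
    also have "\<dots> = (a * s') * (t * t') + (b * t') * (s * s')" using h by simp
    finally have "(a' * t' + b' * s') * (s * t) = (a * t + b * s) * (s' * t')"
      by (simp add: algebra_simps)
    then show ?thesis using h assms by (subst fr_eq) (auto simp: mem T_mult T_C)
  qed
  then have "(\<Union>(a', s')\<in>fr a s. \<Union>(b', t')\<in>fr b t. fr (a' * t' + b' * s') (s' * t')) =
      fr (a * t + b * s) (s * t)"
    by (rule union_fractions[OF assms])
  then show ?thesis by (simp add: localization_def)
qed

lemma cring_L: "cring L"
proof (rule cringI)
  show "abelian_group L"
  proof (rule abelian_groupI)
    fix x y z assume "x \<in> carrier L" "y \<in> carrier L" "z \<in> carrier L"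
    then show "x \<oplus>\<^bsub>L\<^esub> y \<oplus>\<^bsub>L\<^esub> z = x \<oplus>\<^bsub>L\<^esub> (y \<oplus>\<^bsub>L\<^esub> z)"
      by (elim L_cases) (simp add: L_add mem T_mult T_C fr_eq algebra_simps)
  next
    fix x y assume "x \<in> carrier L" "y \<in> carrier L"
    then show "x \<oplus>\<^bsub>L\<^esub> y = y \<oplus>\<^bsub>L\<^esub> x"
      by (elim L_cases) (simp add: L_add mem T_mult T_C fr_eq algebra_simps)
  next
    fix x y assume "x \<in> carrier L" "y \<in> carrier L"
    then show "x \<oplus>\<^bsub>L\<^esub> y \<in> carrier L"
      by (elim L_cases) (simp add: L_add mem T_mult T_C fr_mem)
  next
    fix x assume "x \<in> carrier L"
    then obtain a s where x: "a \<in> C" "s \<in> T" "x = fr a s" by (rule L_cases)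
    then have "fr (- a) s \<oplus>\<^bsub>L\<^esub> x = \<zero>\<^bsub>L\<^esub>"
      by (simp add: L_add L_zero mem T_mult T_C T_one fr_eq algebra_simps)
    then show "\<exists>y\<in>carrier L. y \<oplus>\<^bsub>L\<^esub> x = \<zero>\<^bsub>L\<^esub>"
      using x by (intro bexI[of _ "fr (- a) s"]) (auto simp: fr_mem mem)
  next
    fix x assume "x \<in> carrier L"
    then show "\<zero>\<^bsub>L\<^esub> \<oplus>\<^bsub>L\<^esub> x = x"
      by (elim L_cases) (simp add: L_add L_zero mem T_mult T_C T_one fr_eq)
  qed (simp add: L_zero fr_mem mem T_one)
  show "Group.comm_monoid L"
  proof (rule comm_monoidI)
    fix x y z assume "x \<in> carrier L" "y \<in> carrier L" "z \<in> carrier L"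
    then show "x \<otimes>\<^bsub>L\<^esub> y \<otimes>\<^bsub>L\<^esub> z = x \<otimes>\<^bsub>L\<^esub> (y \<otimes>\<^bsub>L\<^esub> z)"
      by (elim L_cases) (simp add: L_mult mem T_mult T_C fr_eq algebra_simps)
  next
    fix x y assume "x \<in> carrier L" "y \<in> carrier L"
    then show "x \<otimes>\<^bsub>L\<^esub> y = y \<otimes>\<^bsub>L\<^esub> x"
      by (elim L_cases) (simp add: L_mult mem T_mult T_C fr_eq algebra_simps)
  next
    fix x y assume "x \<in> carrier L" "y \<in> carrier L"
    then show "x \<otimes>\<^bsub>L\<^esub> y \<in> carrier L"
      by (elim L_cases) (simp add: L_mult mem T_mult T_C fr_mem)
  next
    fix x assume "x \<in> carrier L"
    then show "\<one>\<^bsub>L\<^esub> \<otimes>\<^bsub>L\<^esub> x = x"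
      by (elim L_cases) (simp add: L_mult L_one mem T_mult T_C T_one fr_eq)
  qed (simp add: L_one fr_mem mem T_one)
  fix x y z assume "x \<in> carrier L" "y \<in> carrier L" "z \<in> carrier L"
  then show "(x \<oplus>\<^bsub>L\<^esub> y) \<otimes>\<^bsub>L\<^esub> z = x \<otimes>\<^bsub>L\<^esub> z \<oplus>\<^bsub>L\<^esub> y \<otimes>\<^bsub>L\<^esub> z"
    by (elim L_cases) (simp add: L_add L_mult mem T_mult T_C fr_eq algebra_simps)
qed

lemmas ideal_L_iff = cring_ideal_iff[OF cring_L]

lemma fr_split: "a \<in> C \<Longrightarrow> s \<in> T \<Longrightarrow> fr a s = fr 1 s \<otimes>\<^bsub>L\<^esub> fr a 1"
  by (simp add: L_mult mem T_one)

lemma L_power: "a \<in> C \<Longrightarrow> fr a 1 [^]\<^bsub>L\<^esub> (n::nat) = fr (a ^ n) 1"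
proof -
  interpret L: cring L by (rule cring_L)
  assume a: "a \<in> C"
  then show ?thesis
    by (induction n) (simp_all add: L_one L_mult mem T_one mult.commute)
qed

text \<open>Contraction and extension of ideals along the map from \<open>R\<close> to
  \<open>L\<close>. As every ideal of \<open>L\<close> is the extension of its contraction
  (\<open>extn_contr\<close>), questions about ideals and prime chains of \<open>L\<close> move to
  \<open>R\<close>.\<close>

definition contr :: "('a \<times> 'a) set set \<Rightarrow> 'a set"
  where "contr J = {a \<in> C. fr a 1 \<in> J}"

definition extn :: "'a set \<Rightarrow> ('a \<times> 'a) set set"
  where "extn I = {fr a s | a s. a \<in> I \<and> s \<in> T}"

lemma fr_mem_ideal_iff:
  assumes "ideal J L" "a \<in> C" "s \<in> T"
  shows "fr a s \<in> J \<longleftrightarrow> a \<in> contr J"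
proof
  assume "fr a s \<in> J"
  then have "fr s 1 \<otimes>\<^bsub>L\<^esub> fr a s \<in> J"
    using assms by (auto simp: ideal_L_iff fr_mem T_C T_one)
  also have "fr s 1 \<otimes>\<^bsub>L\<^esub> fr a s = fr a 1"
    using assms by (simp add: L_mult T_C T_one fr_eq mem ac_simps)
  finally show "a \<in> contr J" using assms by (simp add: contr_def)
next
  assume "a \<in> contr J"
  then have "fr a 1 \<in> J" by (simp add: contr_def)
  then show "fr a s \<in> J" 
    using assms fr_mem[OF one_mem assms(3)] by (auto simp: ideal_L_iff fr_split[of a s])
qed

lemma ideal_contr:
  assumes "ideal J L"
  shows "ideal (contr J) R"
  unfolding ideal_R_iff
proof (intro conjI ballI)
  show "contr J \<subseteq> C" by (auto simp: contr_def)
  show "0 \<in> contr J" using assms by (simp add: ideal_L_iff contr_def L_zero zero_mem)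
  show "x + y \<in> contr J" if "x \<in> contr J" "y \<in> contr J" for x y
  proof -
    have "fr x 1 \<oplus>\<^bsub>L\<^esub> fr y 1 \<in> J" using assms that by (simp add: ideal_L_iff contr_def)
    then show ?thesis using that by (simp add: contr_def L_add T_one mem)
  qed
  show "c * x \<in> contr J" if "c \<in> C" "x \<in> contr J" for c x
  proof -
    have "fr c 1 \<otimes>\<^bsub>L\<^esub> fr x 1 \<in> J" using assms that by (simp add: ideal_L_iff contr_def fr_mem T_one)
    then show ?thesis using that by (simp add: contr_def L_mult T_one mem)
  qed
qed

lemma extn_contr:
  assumes "ideal J L"
  shows "extn (contr J) = J"
proof
  show "extn (contr J) \<subseteq> J"
    using fr_mem_ideal_iff[OF assms] by (auto simp: extn_def contr_def)
  show "J \<subseteq> extn (contr J)"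
  proof
    fix x assume x: "x \<in> J"
    then have "x \<in> carrier L" using assms by (auto simp: ideal_L_iff)
    then obtain a s where "a \<in> C" "s \<in> T" "x = fr a s" by (rule L_cases)
    then show "x \<in> extn (contr J)"
      using x fr_mem_ideal_iff[OF assms] by (auto simp: extn_def)
  qed
qed

lemma ideal_extn:
  assumes "ideal I R"
  shows "ideal (extn I) L"
  unfolding ideal_L_iff
proof (intro conjI ballI)
  have I: "I \<subseteq> C" "0 \<in> I" "\<And>x y. x \<in> I \<Longrightarrow> y \<in> I \<Longrightarrow> x + y \<in> I" "\<And>c x. c \<in> C \<Longrightarrow> x \<in> I \<Longrightarrow> c * x \<in> I"
    using assms by (auto simp: ideal_R_iff)
  show "extn I \<subseteq> carrier L" using I by (auto simp: extn_def intro!: fr_mem)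
  show "\<zero>\<^bsub>L\<^esub> \<in> extn I" using I T_one by (auto simp: extn_def L_zero)
  show "x \<oplus>\<^bsub>L\<^esub> y \<in> extn I" if xy: "x \<in> extn I" "y \<in> extn I" for x y
  proof -
    obtain a s b t where h: "a \<in> I" "s \<in> T" "b \<in> I" "t \<in> T" "x = fr a s" "y = fr b t"
      using xy by (auto simp: extn_def)
    then have "x \<oplus>\<^bsub>L\<^esub> y = fr (t * a + s * b) (s * t)" using I by (simp add: L_add subsetD mult.commute)
    moreover have "t * a + s * b \<in> I" using h I T_C by blast
    moreover have "s * t \<in> T" using h T_mult by blast
    ultimately show ?thesis unfolding extn_def by blast
  qed
  show "c \<otimes>\<^bsub>L\<^esub> x \<in> extn I" if cx: "c \<in> carrier L" "x \<in> extn I" for c x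
  proof -
    obtain a s where h: "a \<in> I" "s \<in> T" "x = fr a s" using cx by (auto simp: extn_def)
    obtain b t where g: "b \<in> C" "t \<in> T" "c = fr b t" using cx(1) by (rule L_cases)
    have "c \<otimes>\<^bsub>L\<^esub> x = fr (b * a) (t * s)" using g h I by (simp add: L_mult subsetD)
    moreover have "b * a \<in> I" using g h I by blast
    moreover have "t * s \<in> T" using g h T_mult by blast
    ultimately show ?thesis unfolding extn_def by blast
  qed
qed

lemma genideal_L_least:
  assumes "ideal I L" "A \<subseteq> I" shows "genideal L A \<subseteq> I"
  using assms by (auto simp: genideal_def)

lemma genideal_R_ideal: "A \<subseteq> C \<Longrightarrow> ideal (genideal R A) R" "A \<subseteq> C \<Longrightarrow> A \<subseteq> genideal R A"
  using ring.genideal_ideal[of R A] ring.genideal_self[of R A] cring_R by (auto simp: cring_def)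

lemma genideal_L_ideal: "A \<subseteq> carrier L \<Longrightarrow> ideal (genideal L A) L" "A \<subseteq> carrier L \<Longrightarrow> A \<subseteq> genideal L A"
  using ring.genideal_ideal[of L A] ring.genideal_self[of L A] cring_L by (auto simp: cring_def)

text \<open>Clears denominators: a generator \<open>a / s\<close> is a unit multiple of
  \<open>a / 1\<close>. Membership in an ideal generated by fractions thus becomes an equation
  between numerators in \<open>R\<close>.\<close>

lemma genideal_L_sub_extn:
  assumes "A \<subseteq> C \<times> T"
  shows "genideal L ((\<lambda>(a, s). fr a s) ` A) \<subseteq> extn (genideal R (fst ` A))"
proof (rule genideal_L_least)
  have C: "fst ` A \<subseteq> C" using assms by auto
  show "ideal (extn (genideal R (fst ` A))) L" using C by (intro ideal_extn genideal_R_ideal)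
  show "(\<lambda>(a, s). fr a s) ` A \<subseteq> extn (genideal R (fst ` A))"
    using genideal_R_ideal(2)[OF C] assms by (fastforce simp: extn_def)
qed

lemma noetherian_L:
  assumes "noetherian_ring R"
  shows "noetherian_ring L"
proof -
  interpret L: cring L by (rule cring_L)
  show ?thesis
  proof (rule L.noetherian_ringI)
    fix J assume J: "ideal J L"
    obtain A where A: "A \<subseteq> C" "finite A" "contr J = genideal R A"
      using noetherian_ring.finetely_gen[OF assms ideal_contr[OF J]] by auto
    let ?B = "(\<lambda>a. fr a 1) ` A"
    have B: "?B \<subseteq> carrier L" using A by (auto intro!: fr_mem T_one)
    have "?B \<subseteq> J"
      using A genideal_R_ideal(2)[OF A(1)] by (auto simp: contr_def)
    then have "genideal L ?B \<subseteq> J" using J by (rule genideal_L_least[rotated])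
    moreover have "J \<subseteq> genideal L ?B"
    proof -
      let ?G = "genideal L ?B"
      have G: "ideal ?G L" using B by (rule genideal_L_ideal)
      have "A \<subseteq> contr ?G" using genideal_L_ideal(2)[OF B] A by (auto simp: contr_def)
      then have "contr J \<subseteq> contr ?G"
        unfolding A(3) using ideal_contr[OF G] by (rule genideal_R_least[rotated])
      then have "extn (contr J) \<subseteq> extn (contr ?G)" by (auto simp: extn_def)
      then show ?thesis by (simp add: extn_contr J G)
    qed
    ultimately show "\<exists>A\<subseteq>carrier L. finite A \<and> J = genideal L A"
      using A B by (intro exI[of _ ?B]) auto
  qed
qed

lemma prime_contr:
  assumes "primeideal q L"
  shows "primeideal (contr q) R"
proof -
  interpret q: primeideal q L by fact
  have q: "ideal q L" "carrier L \<noteq> q"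
    by (rule q.is_ideal, rule q.I_notcarr)
  have "contr q \<noteq> C"
  proof
    assume c: "contr q = C"
    have "q = carrier L" using extn_contr[OF q(1)] unfolding c by (auto simp: extn_def carrier_L)
    then show False using q(2) by simp
  qed
  moreover have "a \<in> contr q \<or> b \<in> contr q" if "a \<in> C" "b \<in> C" "a * b \<in> contr q" for a b
    using q.I_prime[of "fr a 1" "fr b 1"] that by (simp add: contr_def L_mult T_one fr_mem)
  ultimately show ?thesis using ideal_contr[OF q(1)] by (auto simp: primeideal_R_iff)
qed

end


text \<open>A finite supremum in \<open>enat\<close> of a nonempty set is a maximum. Positivity of
  \<open>n\<close> is what rules out the empty set, whose supremum is 0.\<close>

lemma krull_dim_chain:
  assumes "krull_dim R = enat n" "n > 0"
  shows "\<exists>p. (\<forall>i\<le>n. primeideal (p i) R) \<and> (\<forall>i<n. p i \<subset> p (Suc i))"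
proof -
  let ?A = "{enat n | n. \<exists>p. (\<forall>i\<le>n. primeideal (p i) R) \<and> (\<forall>i<n. p i \<subset> p (Suc i))}"
  have S: "Sup ?A = enat n" using assms(1) by (simp add: krull_dim_def)
  have "?A \<noteq> {}"
  proof
    assume "?A = {}"
    then show False using S assms(2) by (simp add: Sup_enat_def zero_enat_def)
  qed
  moreover have "finite ?A"
    using S calculation unfolding Sup_enat_def by (metis enat.distinct(1))
  ultimately have "Sup ?A \<in> ?A" unfolding Sup_enat_def by (metis (no_types, lifting) Max_in)
  then show ?thesis unfolding S by simp
qed

context subdomain
begin

lemma localized_at_prime:
  assumes "primeideal m R"
  shows "localized_subdomain C (C - m)"
proof unfold_locales
  have m: "ideal m R" "m \<noteq> C" "\<And>a b. a \<in> C \<Longrightarrow> b \<in> C \<Longrightarrow> a * b \<in> m \<Longrightarrow> a \<in> m \<or> b \<in> m"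
    using assms unfolding primeideal_R_iff by auto
  show "1 \<in> C - m"
  proof -
    have "1 \<notin> m"
    proof
      assume "1 \<in> m"
      then have "c * 1 \<in> m" if "c \<in> C" for c using m(1) that unfolding ideal_R_iff by blast
      then have "m = C" using m(1) unfolding ideal_R_iff by auto
      then show False using m(2) by simp
    qed
    then show ?thesis by (simp add: one_mem)
  qed
  show "0 \<notin> C - m" using m(1) by (simp add: ideal_R_iff)
  show "x * y \<in> C - m" if "x \<in> C - m" "y \<in> C - m" for x y
    using that m(3) mult_mem by blast
qed simp

end

context localized_subdomain
begin

lemma contr_disjoint:
  assumes "ideal J L" "a \<in> contr J" "a \<in> T"
  shows "J = carrier L"
proof -
  have I: "ideal (contr J) R" using assms(1) by (rule ideal_contr)
  have "fr a a \<in> J" using assms fr_mem_ideal_iff[of J a a] T_C by blast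
  also have "fr a a = fr 1 1" using assms(3) by (simp add: fr_eq T_C T_one mem)
  finally have "fr 1 1 \<in> J" .
  then have one: "1 \<in> contr J" by (simp add: contr_def one_mem)
  have "c \<in> contr J" if "c \<in> C" for c
  proof -
    have "c * 1 \<in> contr J" using I that one unfolding ideal_R_iff by blast
    then show ?thesis by simp
  qed
  moreover have "contr J \<subseteq> C" using I by (simp add: ideal_R_iff)
  ultimately have c: "contr J = C" by blast
  show ?thesis using extn_contr[OF assms(1)] unfolding c by (simp add: extn_def carrier_L)
qed

lemma contr_strict:
  assumes "ideal I L" "ideal J L" "I \<subset> J"
  shows "contr I \<subset> contr J"
proof -
  have "contr I \<noteq> contr J" using extn_contr[OF assms(1)] extn_contr[OF assms(2)] assms(3) by (metis psubset_eq)
  then show ?thesis using assms(3) by (auto simp: contr_def)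
qed

end

section \<open>The local ring at a maximal ideal and its systems of parameters\<close>

locale localized_at_maximal = localized_subdomain C "C - m" for C :: "'a::comm_ring_1 set" and m +
  assumes maximal: "maximalideal m R"
begin

lemma ideal_m: "ideal m R"
  using maximal by (simp add: maximalideal_def)

lemma prime_m: "primeideal m R"
  using cring.maximalideal_prime[OF cring_R maximal] .

lemma fr_extn_m:
  assumes "a \<in> C" "s \<in> C - m" "fr a s \<in> extn m"
  shows "a \<in> m"
proof -
  obtain b t where h: "b \<in> m" "t \<in> C - m" "fr a s = fr b t" using assms(3) by (auto simp: extn_def)
  then have b: "b \<in> C" using ideal_m by (auto simp: ideal_R_iff)
  have "a * t = b * s" using h b assms by (simp add: fr_eq)
  moreover have "s * b \<in> m" using h assms ideal_m by (auto simp: ideal_R_iff)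
  ultimately have "a * t \<in> m" by (simp add: mult.commute)
  then show ?thesis using prime_m assms h by (auto simp: primeideal_R_iff)
qed

lemma proper_ideal_sub:
  assumes "ideal J L" "J \<noteq> carrier L"
  shows "contr J \<subseteq> m"
proof -
  have "a \<notin> C - m" if "a \<in> contr J" for a using contr_disjoint[OF assms(1) that] assms(2) by blast
  then show ?thesis by (auto simp: contr_def)
qed

lemma extn_m_proper: "extn m \<noteq> carrier L"
proof
  assume "extn m = carrier L"
  then have "fr 1 1 \<in> extn m" using fr_mem T_one one_mem by blast
  then have "1 \<in> m" using fr_extn_m T_one one_mem by blast
  then show False using T_one by blast
qed

lemma maximal_ideals_L: "{I. maximalideal I L} = {extn m}"
proof -
  have sub: "J \<subseteq> extn m" if "ideal J L" "J \<noteq> carrier L" for J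
  proof -
    have "extn (contr J) \<subseteq> extn m" using proper_ideal_sub[OF that] by (auto simp: extn_def)
    then show ?thesis by (simp add: extn_contr that)
  qed
  have em: "ideal (extn m) L" by (rule ideal_extn) (rule ideal_m)
  have "maximalideal (extn m) L"
  proof (rule maximalidealI[OF em])
    show "carrier L \<noteq> extn m" using extn_m_proper by simp
    show "J = extn m \<or> J = carrier L" if "ideal J L" "extn m \<subseteq> J" "J \<subseteq> carrier L" for J
      using that sub[of J] by auto
  qed
  moreover have "I = extn m" if "maximalideal I L" for I
  proof -
    interpret I: maximalideal I L by fact
    have "I \<subseteq> extn m" using sub[of I] I.I_notcarr I.is_ideal by auto
    then show ?thesis using I.I_maximal[OF em] extn_m_proper em by (auto simp: ideal_L_iff)
  qed
  ultimately show ?thesis by blast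
qed

text \<open>\<open>H1\<close> and \<open>H2\<close> isolate what has to be known about the
  particular ring. \<open>H2\<close> bounds the dimension of \<open>L\<close> by 2.
  \<open>H1\<close> is a depth condition: modulo any nonzero \<open>x\<close>, no nonzero class is
  killed by a power of \<open>u\<close> and by a power of \<open>v\<close>. The exponents
  \<open>i\<close> and \<open>j\<close> are independent because the radical condition yields
  unrelated powers of \<open>u\<close> and \<open>v\<close>.\<close>

lemma weak_sequence_L:
  assumes sop: "system_of_parameters L (extn m) xs"
    and H1: "\<And>p q. primeideal p R \<Longrightarrow> primeideal q R \<Longrightarrow> p \<noteq> {0} \<Longrightarrow> p \<subset> q \<Longrightarrow> q \<subseteq> m \<Longrightarrow>
      \<exists>u\<in>m. \<exists>v\<in>m. u \<noteq> 0 \<and> (\<forall>i j x y. x \<in> C \<longrightarrow> y \<in> C \<longrightarrow> x \<noteq> 0 \<longrightarrow>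
        (\<exists>c\<in>C. u ^ i * y = c * x) \<longrightarrow> (\<exists>c\<in>C. v ^ j * y = c * x) \<longrightarrow> (\<exists>c\<in>C. y = c * x))"
    and H2: "\<And>p q r. primeideal p R \<Longrightarrow> primeideal q R \<Longrightarrow> primeideal r R \<Longrightarrow>
      p \<noteq> {0} \<Longrightarrow> p \<subset> q \<Longrightarrow> q \<subset> r \<Longrightarrow> False"
  shows "weak_sequence L (extn m) xs"
proof -
  interpret L: cring L by (rule cring_L)
  define n where "n = length xs"
  have m_C: "m \<subseteq> C" using ideal_m by (simp add: ideal_R_iff)
  have em: "ideal (extn m) L" by (rule ideal_extn) (rule ideal_m)
  have emL: "extn m \<subseteq> carrier L" using em by (simp add: ideal_L_iff)
  have xs: "set xs \<subseteq> extn m" "krull_dim L = enat n"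
    and rad: "{y \<in> carrier L. \<exists>k::nat. y [^]\<^bsub>L\<^esub> k \<in> genideal L (set xs)} = extn m"
    using sop by (auto simp: system_of_parameters_def n_def)
  have xsL: "set xs \<subseteq> carrier L" using xs emL by blast
  have absorb: "z \<otimes>\<^bsub>L\<^esub> y \<in> genideal L A" if "A \<subseteq> carrier L" "z \<in> extn m" "y \<in> genideal L A" for z y A
    using genideal_L_ideal(1)[OF that(1)] that emL unfolding ideal_L_iff by blast
  have Idl_empty: "genideal L {} = {\<zero>\<^bsub>L\<^esub>}"
  proof -
    have "genideal L {} \<subseteq> {\<zero>\<^bsub>L\<^esub>}" by (rule genideal_L_least) (simp_all add: L.zeroideal)
    moreover have "\<zero>\<^bsub>L\<^esub> \<in> genideal L {}" using genideal_L_ideal(1)[of "{}"] by (simp add: ideal_L_iff)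
    ultimately show ?thesis by blast
  qed
  have first: "\<forall>z\<in>extn m. z \<otimes>\<^bsub>L\<^esub> y \<in> genideal L {}"
    if xy: "x \<in> carrier L" "x \<noteq> \<zero>\<^bsub>L\<^esub>" "y \<in> carrier L" "y \<otimes>\<^bsub>L\<^esub> x \<in> genideal L {}" for x y
  proof -
    obtain a s where x: "a \<in> C" "s \<in> C - m" "x = fr a s" using xy(1) by (rule L_cases)
    obtain b t where y: "b \<in> C" "t \<in> C - m" "y = fr b t" using xy(3) by (rule L_cases)
    have "fr (b * a) (t * s) = fr 0 1"
      using xy(4) x y by (simp add: Idl_empty L_mult L_zero)
    then have "b * a = 0" using x y T_one T_mult[of t s] by (simp add: fr_eq mem)
    moreover have "a \<noteq> 0" using xy(2) x T_one by (auto simp: L_zero fr_eq mem)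
    ultimately have "b = 0" using no_zero_div x y by blast
    then have "y = \<zero>\<^bsub>L\<^esub>" using y T_one by (simp add: L_zero fr_eq mem)
    then show ?thesis using emL by (auto simp: Idl_empty)
  qed
  have chain: "\<exists>P. (\<forall>i\<le>n. primeideal (P i) R) \<and> (\<forall>i<n. P i \<subset> P (Suc i)) \<and> (\<forall>i\<le>n. P i \<subseteq> m)"
    if n: "n > 0"
  proof -
    obtain P where P: "\<forall>i\<le>n. primeideal (P i) L" "\<forall>i<n. P i \<subset> P (Suc i)"
      using krull_dim_chain[OF xs(2) n] by blast
    have Pi: "ideal (P i) L" "P i \<noteq> carrier L" if "i \<le> n" for i
      using P(1) that by (auto simp: primeideal_def primeideal_axioms_def)
    show ?thesis
    proof (intro exI[of _ "\<lambda>i. contr (P i)"] conjI allI impI)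
      show "primeideal (contr (P i)) R" if "i \<le> n" for i using P(1) that prime_contr by blast
      show "contr (P i) \<subset> contr (P (Suc i))" if "i < n" for i
        using contr_strict P(2) Pi that by auto
      show "contr (P i) \<subseteq> m" if "i \<le> n" for i using proper_ideal_sub Pi that by blast
    qed
  qed
  have nonzero_step: "q \<noteq> {0}" if "primeideal p R" "p \<subset> q" for p q
  proof -
    have "0 \<in> p" using that by (simp add: primeideal_R_iff ideal_R_iff)
    then show ?thesis using that by blast
  qed
  \<comment> \<open>\<open>n\<close> is the length of the sequence and at the same time the Krull
    dimension of \<open>L\<close>.\<close>
  consider "n = 0" | "n = 1" | "n = 2" | "n \<ge> 3" by linarith
  then show ?thesis
  proof cases
    case 1
    then show ?thesis by (simp add: weak_sequence_def n_def)
  next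
    case 2
    then obtain x where x: "xs = [x]" unfolding n_def by (auto simp: length_Suc_conv)
    have xL: "x \<in> carrier L" using xsL x by simp
    show ?thesis
    proof (cases "x = \<zero>\<^bsub>L\<^esub>")
      \<comment> \<open>If the only parameter is 0, the radical condition makes the maximal ideal
        nilpotent elementwise, hence zero in a domain, and multiplying by it always gives 0.\<close>
      case True
      have "extn m \<subseteq> {\<zero>\<^bsub>L\<^esub>}"
      proof
        fix z assume z: "z \<in> extn m"
        then obtain c r where c: "c \<in> C" "r \<in> C - m" "z = fr c r" using emL L_cases by blast
        have "c \<in> m" using fr_extn_m c z by blast
        then have "fr c 1 \<in> extn m" using T_one by (auto simp: extn_def)
        then obtain k :: nat where "fr c 1 [^]\<^bsub>L\<^esub> k \<in> genideal L {\<zero>\<^bsub>L\<^esub>}"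
          using rad x True by auto
        then have "fr (c ^ k) 1 = fr 0 1" using c by (simp add: L.genideal_zero L_power) (simp add: L_zero)
        then have "c ^ k = 0" using c T_one by (simp add: fr_eq mem)
        then have "c = 0" using power_nonzero c by blast
        then show "z \<in> {\<zero>\<^bsub>L\<^esub>}" using c T_one by (simp add: L_zero fr_eq mem)
      qed
      then have "\<forall>y\<in>carrier L. \<forall>z\<in>extn m. z \<otimes>\<^bsub>L\<^esub> y \<in> genideal L {}"
        by (auto simp: Idl_empty)
      then show ?thesis by (simp add: weak_sequence_def x)
    next
      case False
      then show ?thesis using first[OF xL] by (simp add: weak_sequence_def x)
    qed
  next
    case 3
    then obtain x1 x2 where x: "xs = [x1, x2]" unfolding n_def
      by (auto simp: length_Suc_conv numeral_2_eq_2)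
    have xL: "x1 \<in> carrier L" "x2 \<in> carrier L" using xsL x by auto
    obtain P where P: "\<forall>i\<le>n. primeideal (P i) R" "\<forall>i<n. P i \<subset> P (Suc i)" "\<forall>i\<le>n. P i \<subseteq> m"
      using chain 3 by auto
    have P3: "primeideal (P 0) R" "primeideal (P 1) R" "primeideal (P 2) R"
      "P 0 \<subset> P 1" "P 1 \<subset> P 2" "P 2 \<subseteq> m"
      using P 3 by (auto simp: numeral_2_eq_2)
    obtain u v where uv: "u \<in> m" "v \<in> m" "u \<noteq> 0" and H: "\<And>i j x y. x \<in> C \<Longrightarrow> y \<in> C \<Longrightarrow> x \<noteq> 0 \<Longrightarrow>
        \<exists>c\<in>C. u ^ i * y = c * x \<Longrightarrow> \<exists>c\<in>C. v ^ j * y = c * x \<Longrightarrow> \<exists>c\<in>C. y = c * x"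
      using H1[OF P3(2,3) nonzero_step[OF P3(1,4)] P3(5,6)] by blast
    have uvC: "u \<in> C" "v \<in> C" using uv m_C by auto
    obtain a1 s1 where a1: "a1 \<in> C" "s1 \<in> C - m" "x1 = fr a1 s1" using xL(1) by (rule L_cases)
    obtain a2 s2 where a2: "a2 \<in> C" "s2 \<in> C - m" "x2 = fr a2 s2" using xL(2) by (rule L_cases)
    have a2m: "a2 \<in> m" using fr_extn_m a2 xs(1) x by auto
    \<comment> \<open>The factor \<open>t\<close>, a unit of \<open>L\<close>, absorbs all
      denominators when a power of \<open>w\<close> is expressed by the two parameters.\<close>
    have pw: "\<exists>k t c d. t \<in> C - m \<and> c \<in> C \<and> d \<in> C \<and> w ^ k * t = c * a1 + d * a2"
      if w: "w \<in> m" for w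
    proof -
      have wC: "w \<in> C" using w m_C by blast
      have "fr w 1 \<in> extn m" using w T_one by (auto simp: extn_def)
      then obtain k :: nat where "fr w 1 [^]\<^bsub>L\<^esub> k \<in> genideal L {x1, x2}"
        using rad x by auto
      then have "fr (w ^ k) 1 \<in> genideal L {x1, x2}" using wC by (simp add: L_power)
      also have "{x1, x2} = (\<lambda>(a, s). fr a s) ` {(a1, s1), (a2, s2)}" using a1 a2 by simp
      also have "genideal L \<dots> \<subseteq> extn (genideal R (fst ` {(a1, s1), (a2, s2)}))"
        using a1 a2 by (intro genideal_L_sub_extn) auto
      finally obtain e t where e: "e \<in> genideal R {a1, a2}" "t \<in> C - m" "fr (w ^ k) 1 = fr e t"
        by (auto simp: extn_def)
      obtain c d where cd: "c \<in> C" "d \<in> C" "e = c * a1 + d * a2"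
        using genideal_R_pair[OF a1(1) a2(1) e(1)] by blast
      have "w ^ k * t = e * 1" using e cd a1 a2 wC T_one by (subst fr_eq [symmetric]) (auto simp: mem)
      then show ?thesis using e cd by auto
    qed
    obtain k t c d where u: "t \<in> C - m" "c \<in> C" "d \<in> C" "u ^ k * t = c * a1 + d * a2"
      using pw[OF uv(1)] by blast
    obtain k' t' c' d' where v: "t' \<in> C - m" "c' \<in> C" "d' \<in> C" "v ^ k' * t' = c' * a1 + d' * a2"
      using pw[OF uv(2)] by blast
    have tt: "t * t' \<in> C - m" using u v T_mult by blast
    \<comment> \<open>If \<open>a1 = 0\<close>, then \<open>a2\<close> divides both
      \<open>u ^ k * (t * t')\<close> and \<open>v ^ k' * (t * t')\<close>. By \<open>H\<close> it
      divides \<open>t * t'\<close>, which would then lie in \<open>m\<close>.\<close>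
    have a1_nz: "a1 \<noteq> 0"
    proof
      assume a10: "a1 = 0"
      have "u ^ k * t \<noteq> 0"
        using no_zero_div[of "u ^ k" t] power_nonzero[OF uvC(1) uv(3)] u T_nonzero[of t] uvC
        by (auto simp: mem)
      then have "a2 \<noteq> 0" using u a10 by auto
      moreover have "u ^ k * (t * t') = (t' * d) * a2"
      proof -
        have "u ^ k * (t * t') = t' * (u ^ k * t)" by (simp add: ac_simps)
        also have "\<dots> = t' * (d * a2)" using u(4) a10 by simp
        finally show ?thesis by (simp add: ac_simps)
      qed
      moreover have "v ^ k' * (t * t') = (t * d') * a2"
      proof -
        have "v ^ k' * (t * t') = t * (v ^ k' * t')" by (simp add: ac_simps)
        also have "\<dots> = t * (d' * a2)" using v(4) a10 by simp
        finally show ?thesis by (simp add: ac_simps)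
      qed
      moreover have "t' * d \<in> C" "t * d' \<in> C" using u v by (auto simp: mem)
      ultimately have "\<exists>c\<in>C. t * t' = c * a2"
        using tt by (intro H[OF a2(1)]) blast+
      then have "t * t' \<in> m" using a2m ideal_m by (auto simp: ideal_R_iff)
      then show False using tt by blast
    qed
    have x1_nz: "x1 \<noteq> \<zero>\<^bsub>L\<^esub>" using a1 a1_nz T_one by (simp add: L_zero fr_eq mem)
    have second: "\<forall>z\<in>extn m. z \<otimes>\<^bsub>L\<^esub> y \<in> genideal L {x1}"
      if y: "y \<in> carrier L" "y \<otimes>\<^bsub>L\<^esub> x2 \<in> genideal L {x1}" for y
    proof -
      obtain b r where b: "b \<in> C" "r \<in> C - m" "y = fr b r" using y(1) by (rule L_cases)
      have "fr (b * a2) (r * s2) \<in> genideal L {x1}" using y(2) b a2 by (simp add: L_mult)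
      also have "{x1} = (\<lambda>(a, s). fr a s) ` {(a1, s1)}" using a1 by simp
      also have "genideal L \<dots> \<subseteq> extn (genideal R (fst ` {(a1, s1)}))"
        using a1 by (intro genideal_L_sub_extn) auto
      finally obtain e \<sigma> where e: "e \<in> genideal R {a1}" "\<sigma> \<in> C - m" "fr (b * a2) (r * s2) = fr e \<sigma>"
        by (auto simp: extn_def)
      obtain g where g: "g \<in> C" "e = g * a1" using genideal_R_singleton[OF a1(1) e(1)] by blast
      have rs: "r * s2 \<in> C - m" using b a2 T_mult by blast
      have eq: "b * a2 * \<sigma> = g * a1 * (r * s2)"
        using e g a1 a2 b rs by (subst (asm) fr_eq) (auto simp: mem)
      \<comment> \<open>Multiply \<open>w * \<tau> = c * a1 + d * a2\<close> by \<open>b\<close> and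
        replace \<open>b * a2 * \<sigma>\<close> by a multiple of \<open>a1\<close>. The
        complementary factor \<open>\<tau>'\<close> ensures that the instances for \<open>u\<close>
        and for \<open>v\<close> concern the same element
        \<open>t * t' * \<sigma> * b\<close>.\<close>
      have key: "w * (t * t' * \<sigma> * b) = (\<tau>' * (c * \<sigma> * b + d * g * (r * s2))) * a1"
        if "w * \<tau> = c * a1 + d * a2" "\<tau> * \<tau>' = t * t'" for w \<tau> \<tau>' c d
      proof -
        have "w * (t * t' * \<sigma> * b) = (w * \<tau>) * (\<tau>' * \<sigma> * b)" using that(2) [symmetric] by (simp add: ac_simps)
        also have "\<dots> = \<tau>' * (c * a1 * \<sigma> * b + d * (b * a2 * \<sigma>))"
          unfolding that(1) by (simp add: algebra_simps)
        also have "\<dots> = (\<tau>' * (c * \<sigma> * b + d * g * (r * s2))) * a1"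
          unfolding eq by (simp add: algebra_simps)
        finally show ?thesis .
      qed
      have "\<exists>h\<in>C. t * t' * \<sigma> * b = h * a1"
      proof (rule H[of a1 _ k k'])
        show "\<exists>h\<in>C. u ^ k * (t * t' * \<sigma> * b) = h * a1"
          using key[OF u(4), of t'] u v e b g rs a2
          by (intro bexI[of _ "t' * (c * \<sigma> * b + d * g * (r * s2))"]) (auto simp: mem)
        show "\<exists>h\<in>C. v ^ k' * (t * t' * \<sigma> * b) = h * a1"
          using key[OF v(4), of t] u v e b g rs a2
          by (intro bexI[of _ "t * (c' * \<sigma> * b + d' * g * (r * s2))"]) (auto simp: mem ac_simps)
      qed (use a1 a1_nz u v e b in \<open>auto simp: mem\<close>)
      then obtain h where h: "h \<in> C" "t * t' * \<sigma> * b = h * a1" by blast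
      have x1L: "{x1} \<subseteq> carrier L" using xL by simp
      note I = genideal_L_ideal[OF x1L]
      have "a1 \<in> contr (genideal L {x1})" using I a1 fr_mem_ideal_iff[OF I(1)] by auto
      then have "h * a1 \<in> contr (genideal L {x1})"
        using ideal_contr[OF I(1)] h by (auto simp: ideal_R_iff)
      moreover have T': "t * t' * \<sigma> * r \<in> C - m" using tt e b T_mult by blast
      ultimately have "fr (h * a1) (t * t' * \<sigma> * r) \<in> genideal L {x1}"
        using fr_mem_ideal_iff[OF I(1), of "h * a1"] h a1 by (auto simp: mem)
      also have "fr (h * a1) (t * t' * \<sigma> * r) = y"
      proof -
        have "h * a1 * r = b * (t * t' * \<sigma> * r)" unfolding h(2) [symmetric] by (simp add: ac_simps)
        then show ?thesis unfolding b(3) using T' b h a1 by (subst fr_eq) (auto simp: mem)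
      qed
      finally show ?thesis using absorb[OF x1L] by blast
    qed
    show ?thesis
      unfolding weak_sequence_def
    proof (intro allI impI ballI)
      fix i y z
      assume i: "i < length xs" and y: "y \<in> carrier L"
        and yx: "y \<otimes>\<^bsub>L\<^esub> xs ! i \<in> genideal L (set (take i xs))" and z: "z \<in> extn m"
      have "i = 0 \<or> i = 1" using i x by auto
      then show "z \<otimes>\<^bsub>L\<^esub> y \<in> genideal L (set (take i xs))"
        using first[OF xL(1) x1_nz y] second[OF y] yx z x by auto
    qed
  next
    case 4
    then obtain P where P: "\<forall>i\<le>n. primeideal (P i) R" "\<forall>i<n. P i \<subset> P (Suc i)"
      using chain by auto
    have p: "primeideal (P i) R" if "i \<le> 3" for i using P(1) 4 that by simp
    have "P 0 \<subset> P (Suc 0)" "P (Suc 0) \<subset> P (Suc (Suc 0))" "P (Suc (Suc 0)) \<subset> P (Suc (Suc (Suc 0)))"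
      using P(2) 4 by simp_all
    \<comment> \<open>\<open>P 0\<close> may be the zero ideal, so the chain of nonzero primes
      starts at \<open>P 1\<close>; this is why length 3 is needed for the contradiction.\<close>
    then have False
      by (intro H2[of "P (Suc 0)" "P (Suc (Suc 0))" "P (Suc (Suc (Suc 0)))"] p nonzero_step[of "P 0"]) simp_all
    then show ?thesis ..
  qed
qed

end

context subdomain
begin

theorem buchsbaum_ringI:
  assumes noeth: "noetherian_ring R"
    and H1: "\<And>m p q. maximalideal m R \<Longrightarrow> primeideal p R \<Longrightarrow> primeideal q R \<Longrightarrow>
      p \<noteq> {0} \<Longrightarrow> p \<subset> q \<Longrightarrow> q \<subseteq> m \<Longrightarrow>
      \<exists>u\<in>m. \<exists>v\<in>m. u \<noteq> 0 \<and> (\<forall>i j x y. x \<in> C \<longrightarrow> y \<in> C \<longrightarrow> x \<noteq> 0 \<longrightarrow>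
        (\<exists>c\<in>C. u ^ i * y = c * x) \<longrightarrow> (\<exists>c\<in>C. v ^ j * y = c * x) \<longrightarrow> (\<exists>c\<in>C. y = c * x))"
    and H2: "\<And>p q r. primeideal p R \<Longrightarrow> primeideal q R \<Longrightarrow> primeideal r R \<Longrightarrow>
      p \<noteq> {0} \<Longrightarrow> p \<subset> q \<Longrightarrow> q \<subset> r \<Longrightarrow> False"
  shows "buchsbaum_ring R"
proof -
  have "buchsbaum_local_ring (localization R (carrier R - m))" if m: "maximalideal m R" for m
  proof -
    interpret localized_at_maximal C m
      using m localized_at_prime[OF cring.maximalideal_prime[OF cring_R m]]
      by (simp add: localized_at_maximal_def localized_at_maximal_axioms_def)
    have "weak_sequence L (extn m) xs" if "system_of_parameters L (extn m) xs" for xs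
      using that H1[OF m] H2 by (rule weak_sequence_L)
    then show ?thesis
      using cring_L noetherian_L[OF noeth] maximal_ideals_L
      by (auto simp: buchsbaum_local_ring_def)
  qed
  then show ?thesis using cring_R noeth by (simp add: buchsbaum_ring_def)
qed

end


section \<open>Monomial order and reduction\<close>

abbreviation keys where "keys \<equiv> Poly_Mapping.keys"
abbreviation lookup where "lookup \<equiv> Poly_Mapping.lookup"
abbreviation single where "single \<equiv> Poly_Mapping.single"

type_synonym 'k poly2 = "(nat \<times> nat) \<Rightarrow>\<^sub>0 'k"

text \<open>The code of \<open>(a, b)\<close> is \<open>triangle (a + b) + a\<close>, and the codes
  with a given coordinate sum fill the interval between consecutive triangular numbers.\<close>

lemma prod_encode_less_iff:
  "prod_encode (a, b) < prod_encode (c, d) \<longleftrightarrow> a + b < c + d \<or> a + b = c + d \<and> a < c"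
proof -
  have mono: "triangle m \<le> triangle n" if "m \<le> n" for m n
    using that by (induction rule: dec_induct) auto
  have less: "prod_encode (a, b) < prod_encode (c, d)" if "a + b < c + d" for a b c d
  proof -
    have "prod_encode (a, b) < triangle (Suc (a + b))" by (simp add: prod_encode_def)
    also have "\<dots> \<le> triangle (c + d)" using that by (intro mono) simp
    also have "\<dots> \<le> prod_encode (c, d)" by (simp add: prod_encode_def)
    finally show ?thesis .
  qed
  show ?thesis
    using less[of a b c d] less[of c d a b]
    by (cases "a + b" "c + d" rule: linorder_cases) (auto simp: prod_encode_def)
qed

lemma prod_encode_add_less:
  assumes "prod_encode x < prod_encode y"
  shows "prod_encode (x + z) < prod_encode (y + z)"
  using assms by (cases x; cases y; cases z) (auto simp: prod_encode_less_iff)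

lemma prod_encode_add_mono:
  assumes "prod_encode x \<le> prod_encode y" "prod_encode x' \<le> prod_encode y'"
  shows "prod_encode (x + x') \<le> prod_encode (y + y')"
proof -
  have le: "prod_encode (x + z) \<le> prod_encode (y + z)" if "prod_encode x \<le> prod_encode y" for x y z
    using that prod_encode_add_less[of x y z] by (cases "x = y") (auto simp: le_less)
  show ?thesis using le[OF assms(1), of x'] le[OF assms(2), of y] by (simp add: add.commute)
qed

text \<open>The Cantor pairing function is strictly monotone for the graded lexicographic order, so it
  serves as a monomial order of type \<open>\<omega>\<close>.\<close>

definition leading :: "'k::zero poly2 \<Rightarrow> nat \<times> nat \<Rightarrow> bool"
  where "leading f e \<longleftrightarrow> e \<in> keys f \<and> (\<forall>s\<in>keys f. prod_encode s \<le> prod_encode e)"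

lemma leading_exists:
  assumes "f \<noteq> 0"
  shows "\<exists>e. leading f e"
proof -
  have "Max (prod_encode ` keys f) \<in> prod_encode ` keys f" using assms by (intro Max_in) auto
  then obtain e where "e \<in> keys f" "prod_encode e = Max (prod_encode ` keys f)" by fastforce
  then show ?thesis unfolding leading_def by (intro exI[of _ e]) auto
qed

lemma lookup_single_mult:
  fixes h :: "'k::comm_semiring_1 poly2"
  shows "lookup (single s c * h) (s + k) = c * lookup h k"
proof -
  have "lookup (single s c * h) (s + k) = (\<Sum>l. (c when s = l) * (\<Sum>q. lookup h q when s + k = l + q))"
    by (simp add: lookup_mult lookup_single)
  also have "\<dots> = (\<Sum>l. (c * (\<Sum>q. lookup h q when s + k = l + q)) when s = l)"
    by (simp add: when_mult)
  also have "\<dots> = c * (\<Sum>q. lookup h q when k = q)" by simp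
  finally show ?thesis by simp
qed

lemma lookup_scale:
  fixes h :: "'k::comm_semiring_1 poly2"
  shows "lookup (single 0 c * h) k = c * lookup h k"
  using lookup_single_mult[of 0 c h k] by simp

text \<open>Only the pair \<open>(e, e')\<close> contributes to the exponent \<open>e + e'\<close>:
  a smaller exponent of \<open>f\<close> would need a larger one of \<open>g\<close>. The two
  exponents are mere upper bounds here and may be absent from the supports.\<close>

lemma lookup_mult_leading:
  fixes f g :: "'k::comm_semiring_1 poly2"
  assumes f: "\<forall>s\<in>keys f. prod_encode s \<le> prod_encode e"
    and g: "\<forall>s\<in>keys g. prod_encode s \<le> prod_encode e'"
  shows "lookup (f * g) (e + e') = lookup f e * lookup g e'"
proof -
  have "lookup f l * (\<Sum>q. lookup g q when e + e' = l + q) = (lookup f l * lookup g e' when l = e)" for l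
  proof (cases "l = e \<or> l \<notin> keys f")
    case True
    then show ?thesis by (auto simp: not_in_keys_iff_lookup_eq_zero)
  next
    case False
    then have l: "prod_encode l < prod_encode e" using f by (auto simp: less_le)
    have "(lookup g q when e + e' = l + q) = 0" for q
    proof (rule ccontr)
      assume "\<not> ?thesis"
      then have q: "e + e' = l + q" "q \<in> keys g" by (auto simp: in_keys_iff)
      have "prod_encode (l + q) < prod_encode (e + q)" using l by (rule prod_encode_add_less)
      also have "\<dots> \<le> prod_encode (e + e')" using g q by (intro prod_encode_add_mono) auto
      finally show False using q by simp
    qed
    then show ?thesis using False by simp
  qed
  then show ?thesis by (simp add: lookup_mult)
qed

lemma leading_mult:
  fixes f g :: "'k::field poly2"
  assumes "leading f e" "leading g e'"
  shows "leading (f * g) (e + e')"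
  unfolding leading_def
proof
  have "lookup (f * g) (e + e') = lookup f e * lookup g e'"
    using assms by (intro lookup_mult_leading) (auto simp: leading_def)
  then show "e + e' \<in> keys (f * g)" using assms by (auto simp: leading_def in_keys_iff)
  show "\<forall>s\<in>keys (f * g). prod_encode s \<le> prod_encode (e + e')"
  proof
    fix s assume "s \<in> keys (f * g)"
    then obtain x y where "s = x + y" "x \<in> keys f" "y \<in> keys g" using keys_mult by blast
    then show "prod_encode s \<le> prod_encode (e + e')"
      using assms by (auto simp: leading_def intro: prod_encode_add_mono)
  qed
qed

lemma leading_nonzero: "leading f e \<Longrightarrow> f \<noteq> 0"
  by (auto simp: leading_def)

lemma leading_single: "c \<noteq> 0 \<Longrightarrow> leading (single s c) s"
  by (simp add: leading_def)

lemma poly2_no_zero_div: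
  fixes f g :: "'k::field poly2"
  assumes "f * g = 0"
  shows "f = 0 \<or> g = 0"
  using leading_mult[of f _ g] leading_exists[of f] leading_exists[of g] leading_nonzero assms by metis

lemma keys_diff: "keys (f - g) \<subseteq> keys f \<union> keys (g :: 'k::ab_group_add poly2)"
  by (auto simp: in_keys_iff lookup_minus)

text \<open>Scalars act as constant polynomials. This common weakening covers ideals, the multiples
  of a fixed polynomial and generated subalgebras, so that one reduction lemma serves all of
  them.\<close>

definition poly_subspace :: "'k::field poly2 set \<Rightarrow> bool"
  where "poly_subspace W \<longleftrightarrow> 0 \<in> W \<and> (\<forall>f\<in>W. \<forall>g\<in>W. f + g \<in> W) \<and> (\<forall>c. \<forall>f\<in>W. single 0 c * f \<in> W)"

lemma poly_subspace_sum:
  assumes "poly_subspace W" "\<And>i. i \<in> I \<Longrightarrow> f i \<in> W"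
  shows "sum f I \<in> W"
  using assms(2)
proof (induction I rule: infinite_finite_induct)
qed (use assms(1) in \<open>auto simp: poly_subspace_def\<close>)

text \<open>Division with remainder modulo \<open>W\<close>. The term of code \<open>N - 1\<close>
  is kept if its exponent is in \<open>M\<close>; otherwise a scaled element of \<open>W\<close>
  with that leading exponent cancels it. \<open>U\<close> keeps all intermediate polynomials inside
  the ring in question. The bound \<open>N\<close> is retained for the remainder because the
  counting argument needs to control its degree.\<close>

lemma reduction:
  fixes W :: "'k::field poly2 set"
  assumes W: "poly_subspace W"
    and red: "\<And>s. s \<in> U \<Longrightarrow> s \<notin> M \<Longrightarrow> \<exists>h\<in>W. leading h s \<and> keys h \<subseteq> U"
  shows "keys r \<subseteq> U \<Longrightarrow> \<forall>s\<in>keys r. prod_encode s < N \<Longrightarrow>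
    \<exists>r'. keys r' \<subseteq> {s \<in> M \<inter> U. prod_encode s < N} \<and> r - r' \<in> W"
proof (induction N arbitrary: r)
  case 0
  then have "keys r = {}" by (meson all_not_in_conv not_less0)
  then have "r = 0" by simp
  then show ?case using W by (intro exI[of _ 0]) (auto simp: poly_subspace_def)
next
  case (Suc N)
  define s where "s = prod_decode N"
  have s: "prod_encode t = N \<longleftrightarrow> t = s" for t by (auto simp: s_def)
  show ?case
  proof (cases "s \<in> keys r")
    case False
    then have "\<forall>t\<in>keys r. prod_encode t < N" using Suc.prems(2) s by (metis less_SucE)
    then obtain r' where "keys r' \<subseteq> {s \<in> M \<inter> U. prod_encode s < N}" "r - r' \<in> W"
      using Suc.IH Suc.prems(1) by blast
    then show ?thesis by (intro exI[of _ r']) auto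
  next
    case True
    then have sU: "s \<in> U" using Suc.prems by blast
    have IH': "\<exists>r'. keys r' \<subseteq> {s \<in> M \<inter> U. prod_encode s < N} \<and> (r - g) - r' \<in> W"
      if "keys g \<subseteq> U" "lookup g s = lookup r s" "\<forall>t\<in>keys g. prod_encode t \<le> N" for g
    proof (rule Suc.IH)
      show "keys (r - g) \<subseteq> U" using that Suc.prems keys_diff[of r g] by auto
      show "\<forall>t\<in>keys (r - g). prod_encode t < N"
      proof
        fix t assume t: "t \<in> keys (r - g)"
        then have "prod_encode t \<le> N" using that(3) Suc.prems(2) keys_diff[of r g] by fastforce
        moreover have "t \<noteq> s" using t that(2) by (auto simp: in_keys_iff lookup_minus)
        ultimately show "prod_encode t < N" using s[of t] by auto
      qed
    qed
    show ?thesis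
    proof (cases "s \<in> M")
      case sM: True
      have "keys (single s (lookup r s)) \<subseteq> {s}" by simp
      then have "keys (single s (lookup r s)) \<subseteq> U"
        "\<forall>t\<in>keys (single s (lookup r s)). prod_encode t \<le> N"
        using sU s[of s] by auto
      then obtain r' where r': "keys r' \<subseteq> {s \<in> M \<inter> U. prod_encode s < N}"
        "(r - single s (lookup r s)) - r' \<in> W"
        using IH'[of "single s (lookup r s)"] by (meson lookup_single_eq)
      have "keys (r' + single s (lookup r s)) \<subseteq> {s \<in> M \<inter> U. prod_encode s < Suc N}"
      proof
        fix t assume "t \<in> keys (r' + single s (lookup r s))"
        then have "t \<in> keys r' \<or> t = s"
          using keys_add[of r' "single s (lookup r s)"] by (auto split: if_splits)
        then show "t \<in> {s \<in> M \<inter> U. prod_encode s < Suc N}"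
          using r'(1) sM sU s[of s] by auto
      qed
      then show ?thesis using r'(2)
        by (intro exI[of _ "r' + single s (lookup r s)"]) (simp add: algebra_simps)
    next
      case False
      then obtain h where h: "h \<in> W" "leading h s" "keys h \<subseteq> U" using red sU by blast
      define g where "g = single 0 (lookup r s / lookup h s) * h"
      have kg: "keys g \<subseteq> keys h" by (auto simp: g_def in_keys_iff lookup_scale)
      have "lookup g s = lookup r s"
        using h(2) by (simp add: g_def lookup_scale leading_def in_keys_iff)
      moreover have "\<forall>t\<in>keys g. prod_encode t \<le> N" using kg h(2) s[of s] by (auto simp: leading_def)
      ultimately obtain r' where r': "keys r' \<subseteq> {s \<in> M \<inter> U. prod_encode s < N}" "(r - g) - r' \<in> W"
        using IH'[of g] kg h(3) by blast
      have "g \<in> W" using h(1) W by (auto simp: g_def poly_subspace_def)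
      then have "((r - g) - r') + g \<in> W" using r'(2) W unfolding poly_subspace_def by blast
      then have "r - r' \<in> W" by (simp add: algebra_simps)
      then show ?thesis using r'(1) by (intro exI[of _ r']) auto
    qed
  qed
qed

lemma reduction':
  fixes W :: "'k::field poly2 set"
  assumes "poly_subspace W" "\<And>s. s \<in> U \<Longrightarrow> s \<notin> M \<Longrightarrow> \<exists>h\<in>W. leading h s \<and> keys h \<subseteq> U" "keys r \<subseteq> U"
  shows "\<exists>r'. keys r' \<subseteq> M \<inter> U \<and> r - r' \<in> W"
proof -
  define N where "N = Suc (Max (insert 0 (prod_encode ` keys r)))"
  have N: "\<forall>s\<in>keys r. prod_encode s < N" by (auto simp: N_def less_Suc_eq_le)
  have "\<exists>r'. keys r' \<subseteq> {s \<in> M \<inter> U. prod_encode s < N} \<and> r - r' \<in> W"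
    by (rule reduction) (fact assms N)+
  then show ?thesis by auto
qed

section \<open>Linear algebra: dependence modulo a subspace\<close>

lemma homogeneous_system:
  fixes A :: "'i \<Rightarrow> 'b \<Rightarrow> 'k::field"
  assumes "finite B"
  shows "finite I \<Longrightarrow> card B < card I \<Longrightarrow> \<exists>c. (\<exists>i\<in>I. c i \<noteq> 0) \<and> (\<forall>b\<in>B. (\<Sum>i\<in>I. c i * A i b) = 0)"
  using assms
proof (induction B arbitrary: I A rule: finite_induct)
  case empty
  then obtain i where "i \<in> I" by fastforce
  then show ?case by (intro exI[of _ "\<lambda>_. 1"]) auto
next
  case (insert b B)
  show ?case
  proof (cases "\<exists>j\<in>I. A j b \<noteq> 0")
    case False
    then obtain c where "\<exists>i\<in>I. c i \<noteq> 0" "\<forall>b\<in>B. (\<Sum>i\<in>I. c i * A i b) = 0"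
      using insert.IH[of I A] insert.prems insert.hyps by auto
    then show ?thesis using False by (intro exI[of _ c]) auto
  next
    case True
    then obtain j where j: "j \<in> I" "A j b \<noteq> 0" by blast
    \<comment> \<open>Gaussian elimination with pivot \<open>A j b\<close>: the coefficients of
      equation \<open>b\<close> become 0, and the unknown \<open>j\<close> is recovered from the
      others in \<open>c'\<close>.\<close>
    define A' where "A' = (\<lambda>i b'. A i b' - A i b / A j b * A j b')"
    have "card B < card (I - {j})" using insert.prems insert.hyps j by simp
    then obtain c where c: "\<exists>i\<in>I - {j}. c i \<noteq> 0" "\<forall>b\<in>B. (\<Sum>i\<in>I - {j}. c i * A' i b) = 0"
      using insert.IH[of "I - {j}" A'] insert.prems by auto
    define c' where "c' = c(j := - (\<Sum>i\<in>I - {j}. c i * (A i b / A j b)))"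
    have split: "(\<Sum>i\<in>I. c' i * A i b') = (\<Sum>i\<in>I - {j}. c i * A' i b')" for b'
    proof -
      have "(\<Sum>i\<in>I. c' i * A i b') = c' j * A j b' + (\<Sum>i\<in>I - {j}. c' i * A i b')"
        using j insert.prems by (simp add: sum.remove)
      also have "(\<Sum>i\<in>I - {j}. c' i * A i b') = (\<Sum>i\<in>I - {j}. c i * A i b')"
        by (intro sum.cong) (auto simp: c'_def)
      also have "c' j * A j b' = - (\<Sum>i\<in>I - {j}. c i * (A i b / A j b) * A j b')"
        by (simp add: c'_def sum_distrib_right)
      finally show ?thesis
        by (simp add: A'_def sum_subtractf [symmetric] algebra_simps)
    qed
    have "(\<Sum>i\<in>I. c' i * A i b) = 0" using split[of b] j by (simp add: A'_def)
    moreover have "\<exists>i\<in>I. c' i \<noteq> 0" using c(1) by (auto simp: c'_def)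
    ultimately show ?thesis using c(2) split by (intro exI[of _ c']) auto
  qed
qed

text \<open>The remainders lie in the span of \<open>card B\<close> monomials, too few for
  \<open>card I\<close> of them to be independent. The dependence found for the remainders holds for
  the \<open>v i\<close> modulo \<open>W\<close>.\<close>

lemma dependent_modulo:
  fixes W :: "'k::field poly2 set"
  assumes W: "poly_subspace W" and fin: "finite B" "finite I" and card: "card B < card I"
    and red: "\<And>i. i \<in> I \<Longrightarrow> \<exists>r. keys r \<subseteq> B \<and> v i - r \<in> W"
  shows "\<exists>c. (\<exists>i\<in>I. c i \<noteq> 0) \<and> (\<Sum>i\<in>I. single 0 (c i) * v i) \<in> W"
proof -
  obtain r where r: "\<And>i. i \<in> I \<Longrightarrow> keys (r i) \<subseteq> B \<and> v i - r i \<in> W" using red by metis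
  obtain c where c: "\<exists>i\<in>I. c i \<noteq> 0" "\<forall>b\<in>B. (\<Sum>i\<in>I. c i * lookup (r i) b) = 0"
    using homogeneous_system[OF fin card, of "\<lambda>i. lookup (r i)"] by blast
  have "lookup (\<Sum>i\<in>I. single 0 (c i) * r i) b = 0" for b
  proof (cases "b \<in> B")
    case True
    then show ?thesis using c(2) by (simp add: lookup_sum lookup_scale)
  next
    case False
    then have "lookup (r i) b = 0" if "i \<in> I" for i using r[OF that] by (auto simp: in_keys_iff)
    then show ?thesis by (simp add: lookup_sum lookup_scale)
  qed
  then have "(\<Sum>i\<in>I. single 0 (c i) * r i) = 0" by (intro poly_mapping_eqI) simp
  then have "(\<Sum>i\<in>I. single 0 (c i) * v i) = (\<Sum>i\<in>I. single 0 (c i) * (v i - r i))"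
    by (simp add: right_diff_distrib sum_subtractf)
  also have "\<dots> \<in> W" using W r by (intro poly_subspace_sum) (auto simp: poly_subspace_def)
  finally show ?thesis using c(1) by blast
qed


section \<open>Cohen-Macaulay monoids of exponents\<close>

context subdomain
begin

text \<open>A relation of least degree between the powers of \<open>z\<close> modulo \<open>p\<close> has a nonzero constant
  term, which then lies in \<open>q\<close>.\<close>

lemma constant_term_of_relation:
  assumes p: "primeideal p R" and q: "ideal q R" "p \<subseteq> q" and z: "z \<in> q" "z \<notin> p" and G: "G \<subseteq> C"
  shows "(\<And>j. j < n \<Longrightarrow> g j \<in> G) \<Longrightarrow> \<exists>j<n. g j \<noteq> 0 \<Longrightarrow> (\<Sum>j<n. g j * z ^ j) \<in> p \<Longrightarrow> \<exists>f\<in>G. f \<noteq> 0 \<and> f \<in> q"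
proof (induction n arbitrary: g)
  case 0
  then show ?case by simp
next
  case (Suc n)
  define h where "h = (\<Sum>j<n. g (Suc j) * z ^ j)"
  have eq: "(\<Sum>j<Suc n. g j * z ^ j) = g 0 + h * z"
    by (simp add: sum.lessThan_Suc_shift h_def sum_distrib_right mult.assoc power_commutes del: sum.lessThan_Suc)
  have zC: "z \<in> C" using z(1) q(1) by (auto simp: ideal_R_iff)
  have "(\<Sum>j<k. g (Suc j) * z ^ j) \<in> C" if "k \<le> n" for k
    using that
  proof (induction k)
    case (Suc k)
    then have "g (Suc k) \<in> C" using Suc.prems \<open>\<And>j. j < Suc n \<Longrightarrow> g j \<in> G\<close> G by auto
    then show ?case using Suc zC by (simp add: mem)
  qed (simp add: mem)
  then have hC: "h \<in> C" by (simp add: h_def)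
  show ?case
  proof (cases "g 0 = 0")
    case False
    have "- (h * z) \<in> q"
    proof -
      have "(- h) * z \<in> q" using q(1) z(1) uminus_mem[OF hC] unfolding ideal_R_iff by blast
      then show ?thesis by simp
    qed
    moreover have "g 0 + h * z \<in> q" using Suc.prems(3) q(2) unfolding eq by blast
    ultimately have "(g 0 + h * z) + - (h * z) \<in> q" using q(1) unfolding ideal_R_iff by blast
    then show ?thesis using False Suc.prems(1)[of 0] by auto
  next
    case True
    then have "h * z \<in> p" using Suc.prems(3) unfolding eq by simp
    then have "h \<in> p" using p z(2) hC zC unfolding primeideal_R_iff by blast
    moreover have "\<exists>j<n. g (Suc j) \<noteq> 0" using Suc.prems(2) True by (metis less_Suc_eq_0_disj)
    ultimately show ?thesis using Suc.IH[of "\<lambda>j. g (Suc j)"] Suc.prems(1) by (simp add: h_def)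
  qed
qed

end

section \<open>Multiples of exponents and Dickson's lemma for pairs\<close>

definition nsmul :: "nat \<Rightarrow> nat \<times> nat \<Rightarrow> nat \<times> nat"
  where "nsmul n s = (n * fst s, n * snd s)"

lemma fst_nsmul [simp]: "fst (nsmul n s) = n * fst s" and snd_nsmul [simp]: "snd (nsmul n s) = n * snd s"
  by (simp_all add: nsmul_def)

lemma nsmul_0 [simp]: "nsmul 0 s = 0"
  by (simp add: nsmul_def zero_prod_def)

lemma nsmul_1 [simp]: "nsmul (Suc 0) s = s"
  by (simp add: nsmul_def)

lemma nsmul_add: "nsmul (m + n) s = nsmul m s + nsmul n s"
  by (simp add: prod_eq_iff algebra_simps)

lemma nsmul_add_right: "nsmul n (s + t) = nsmul n s + nsmul n t"
  by (simp add: prod_eq_iff algebra_simps)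

lemma nsmul_nsmul: "nsmul m (nsmul n s) = nsmul (m * n) s"
  by (simp add: prod_eq_iff algebra_simps)

lemma nsmul_cancel: "m > 0 \<Longrightarrow> nsmul m s = nsmul m t \<longleftrightarrow> s = t"
  by (auto simp: prod_eq_iff)

text \<open>Fix one pair \<open>(i0, j0)\<close> with the property. A pair not above it lies in one
  of finitely many rows or columns, and each of these has a least member.\<close>

lemma dickson_nat_pairs:
  fixes P :: "nat \<Rightarrow> nat \<Rightarrow> bool"
  shows "\<exists>F. finite F \<and> (\<forall>k l. (k, l) \<in> F \<longrightarrow> P k l) \<and>
    (\<forall>i j. P i j \<longrightarrow> (\<exists>k l. (k, l) \<in> F \<and> k \<le> i \<and> l \<le> j))"
proof (cases "\<exists>i j. P i j")
  case True
  then obtain i0 j0 where ij: "P i0 j0" by blast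
  \<comment> \<open>The intersection removes the arbitrary values of \<open>LEAST\<close> on rows
    and columns without any member.\<close>
  define F where "F = {(i, j). P i j} \<inter> (insert (i0, j0) ((\<lambda>i. (i, LEAST j. P i j)) ` {..<i0} \<union>
    (\<lambda>j. (LEAST i. P i j, j)) ` {..<j0}))"
  have "\<exists>k l. (k, l) \<in> F \<and> k \<le> i \<and> l \<le> j" if m: "P i j" for i j
  proof -
    consider "i < i0" | "j < j0" | "i0 \<le> i" "j0 \<le> j" by linarith
    then show ?thesis
    proof cases
      case 1
      have "P i (LEAST j. P i j)" "(LEAST j. P i j) \<le> j"
        using m by (rule LeastI, rule Least_le)
      then show ?thesis using 1 by (intro exI[of _ i] exI[of _ "LEAST j. P i j"]) (auto simp: F_def)
    next
      case 2
      have "P (LEAST i. P i j) j" "(LEAST i. P i j) \<le> i"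
        using m by (rule LeastI, rule Least_le)
      then show ?thesis using 2 by (intro exI[of _ "LEAST i. P i j"] exI[of _ j]) (auto simp: F_def)
    next
      case 3
      then show ?thesis using ij by (intro exI[of _ i0] exI[of _ j0]) (auto simp: F_def)
    qed
  qed
  moreover have "finite F" "\<And>k l. (k, l) \<in> F \<Longrightarrow> P k l" by (auto simp: F_def)
  ultimately show ?thesis by blast
qed auto

section \<open>The semigroup ring as polynomials with exponents in the monoid\<close>

locale exponent_monoid =
  fixes S :: "(nat \<times> nat) set"
  assumes zero_S: "0 \<in> S" and add_S: "\<And>s t. s \<in> S \<Longrightarrow> t \<in> S \<Longrightarrow> s + t \<in> S"
begin

lemma nsmul_S: "s \<in> S \<Longrightarrow> nsmul n s \<in> S"
proof (induction n)
  case (Suc n)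
  then show ?case using add_S nsmul_add[of n "Suc 0" s] by simp
qed (simp add: zero_S)

definition supported :: "'k::field poly2 set"
  where "supported = {f. keys f \<subseteq> S}"

lemma supported_mult:
  assumes "f \<in> supported" "g \<in> supported" shows "f * g \<in> supported"
  using assms keys_mult[of f g] add_S by (force simp: supported_def)

lemma supported_add:
  assumes "f \<in> supported" "g \<in> supported" shows "f + g \<in> supported"
  using assms keys_add[of f g] by (auto simp: supported_def)

lemma supported_single: "s \<in> S \<Longrightarrow> single s c \<in> supported"
  by (simp add: supported_def)

sublocale subdomain "supported :: 'k::field poly2 set"
proof
  show "1 \<in> (supported :: 'k poly2 set)" by (simp add: supported_def zero_S)
  show "- x \<in> supported" if "x \<in> supported" for x :: "'k poly2"
    using that by (auto simp: supported_def in_keys_iff)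
  show "x = 0 \<or> y = 0" if "x * y = 0" for x y :: "'k poly2"
    using that by (rule poly2_no_zero_div)
qed (simp_all add: supported_add supported_mult)

lemma ideal_subspace:
  assumes "ideal I (subring_of (supported :: 'k::field poly2 set))"
  shows "poly_subspace I"
  using assms zero_S by (simp add: ideal_R_iff poly_subspace_def supported_single)

text \<open>For the inclusion of \<open>supported\<close>, reduce modulo the generated ring, viewed
  as a subspace, with \<open>M\<close> empty: every exponent in \<open>S\<close> leads a monomial
  generator, so the remainder has no terms.\<close>

lemma semigroup_ring_eq: "semigroup_ring S = subring_of (supported :: 'k::field poly2 set)"
proof -
  let ?H = "Set.range (single 0) \<union> (\<lambda>s. single s 1) ` S :: 'k poly2 set"
  let ?A = "ring_of_type_algebra :: 'k poly2 ring"
  let ?W = "generate_ring ?A ?H"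
  interpret A: cring ?A by (rule cring_from_type_algebra)
  have ops: "x \<otimes>\<^bsub>?A\<^esub> y = x * y" "x \<oplus>\<^bsub>?A\<^esub> y = x + y" "\<one>\<^bsub>?A\<^esub> = 1" "\<zero>\<^bsub>?A\<^esub> = 0" "carrier ?A = UNIV" for x y
    by (simp_all add: ring_of_type_algebra_def)
  have neg: "\<ominus>\<^bsub>?A\<^esub> x = - x" for x
    by (rule A.minus_equality) (simp_all add: ops)
  have mult: "x * y \<in> ?W" if "x \<in> ?W" "y \<in> ?W" for x y
    using generate_ring.eng_mult[OF that] by (simp add: ops)
  have add: "x + y \<in> ?W" if "x \<in> ?W" "y \<in> ?W" for x y
    using generate_ring.eng_add[OF that] by (simp add: ops)
  have const: "single 0 c \<in> ?W" for c by (rule generate_ring.incl) simp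
  have W: "poly_subspace ?W"
    unfolding poly_subspace_def using const[of 0] const mult add by simp
  have "?W = supported"
  proof
    show "?W \<subseteq> supported"
    proof
      fix x assume "x \<in> ?W"
      then show "x \<in> supported"
      proof (induction rule: generate_ring.induct)
        case (incl h)
        then show ?case by (auto intro!: supported_single zero_S)
      qed (simp_all add: ops neg mem)
    qed
    show "supported \<subseteq> ?W"
    proof
      fix x :: "'k poly2" assume "x \<in> supported"
      then have "keys x \<subseteq> S" by (simp add: supported_def)
      moreover have "\<exists>h\<in>?W. leading h s \<and> keys h \<subseteq> S" if "s \<in> S" for s
        using that by (intro bexI[of _ "single s 1"] generate_ring.incl) (auto simp: leading_single)
      ultimately have "\<exists>r'. keys r' \<subseteq> {} \<inter> S \<and> x - r' \<in> ?W"
        by (intro reduction'[OF W]) auto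
      then show "x \<in> ?W" by auto
    qed
  qed
  then show ?thesis by (simp add: semigroup_ring_def subring_of_def)
qed

end

text \<open>\<open>a\<close> and \<open>b\<close> span the cone of \<open>S\<close>, with
  \<open>D\<close> a common denominator of the coordinates. \<open>criterion\<close> is the
  classical Cohen-Macaulay condition for simplicial semigroups, stated without subtraction: the
  integer vector \<open>x = s - i a = t - j b\<close> might a priori have negative entries, and the
  claim is that it lies in \<open>S\<close>.\<close>

locale cm_monoid = exponent_monoid S for S +
  fixes a b :: "nat \<times> nat" and D :: nat
  assumes a_S: "a \<in> S" and b_S: "b \<in> S" and a_nz: "a \<noteq> 0" and b_nz: "b \<noteq> 0" and D_pos: "D > 0"
    and cone: "\<And>s. s \<in> S \<Longrightarrow> \<exists>i j. nsmul D s = nsmul i a + nsmul j b"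
    and criterion: "\<And>s t i j. s \<in> S \<Longrightarrow> t \<in> S \<Longrightarrow> s + nsmul j b = t + nsmul i a \<Longrightarrow>
      \<exists>x\<in>S. s = x + nsmul i a"
begin

text \<open>The element supplied by the criterion, \<open>t - j a\<close>, equals
  \<open>s - i b\<close>. Every result about \<open>a\<close> thereby becomes available for
  \<open>b\<close>.\<close>

lemma swap: "cm_monoid S b a D"
proof
  show "\<exists>i j. nsmul D s = nsmul i b + nsmul j a" if "s \<in> S" for s
    using cone[OF that] by (metis add.commute)
  show "\<exists>x\<in>S. s = x + nsmul i b" if h: "s \<in> S" "t \<in> S" "s + nsmul j a = t + nsmul i b" for s t i j
  proof -
    obtain x where x: "x \<in> S" "t = x + nsmul j a" using criterion[OF h(2,1) h(3)[symmetric]] by blast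
    then have "s = x + nsmul i b" using h(3) by (simp add: prod_eq_iff)
    then show ?thesis using x by blast
  qed
qed (use a_S b_S a_nz b_nz D_pos in auto)

text \<open>The Apery set of \<open>S\<close> with respect to \<open>d a\<close> and
  \<open>e b\<close>. The multiples \<open>d\<close> and \<open>e\<close> are needed since leading
  exponents of polynomials in \<open>t^a\<close> and \<open>t^b\<close> are arbitrary multiples of
  \<open>a\<close> and \<open>b\<close>.\<close>

definition apery :: "nat \<Rightarrow> nat \<Rightarrow> (nat \<times> nat) set"
  where "apery d e = {s \<in> S. (\<forall>x\<in>S. s \<noteq> x + nsmul d a) \<and> (\<forall>x\<in>S. s \<noteq> x + nsmul e b)}"

text \<open>With \<open>K = D * d * e\<close>, every \<open>K s\<close> has natural coordinates with
  respect to \<open>d a\<close> and \<open>e b\<close>. Two Apery elements whose coordinates agree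
  modulo \<open>K\<close> coincide, so there are at most \<open>K * K\<close> of them.\<close>

lemma finite_apery: "finite (apery d e)"
proof (cases "d = 0 \<or> e = 0")
  case True
  then have "apery d e = {}" by (auto simp: apery_def)
  then show ?thesis by simp
next
  case False
  define K where "K = D * d * e"
  have K: "K > 0" using False D_pos by (simp add: K_def)
  let ?a = "nsmul d a" and ?b = "nsmul e b"
  have "\<exists>i j. nsmul K s = nsmul i ?a + nsmul j ?b" if s: "s \<in> S" for s
  proof -
    obtain i j where ij: "nsmul D s = nsmul i a + nsmul j b" using cone[OF s] by blast
    have "nsmul K s = nsmul (d * e) (nsmul D s)" by (simp add: K_def nsmul_nsmul ac_simps)
    also have "\<dots> = nsmul (i * e) ?a + nsmul (j * d) ?b"
      unfolding ij by (simp add: nsmul_add_right nsmul_nsmul ac_simps)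
    finally show ?thesis by blast
  qed
  then obtain f g where fg: "\<And>s. s \<in> S \<Longrightarrow> nsmul K s = nsmul (f s) ?a + nsmul (g s) ?b" by metis
  have key: "s = t" if s: "s \<in> apery d e" and t: "t \<in> apery d e" and le: "f s \<le> f t"
    and cong: "f s mod K = f t mod K" "g s mod K = g t mod K" for s t
  proof -
    have S: "s \<in> S" "t \<in> S" using s t by (auto simp: apery_def)
    obtain k where k: "f t = f s + K * k" using cong(1) le by (metis mod_eq_nat2E)
    have up: "t \<noteq> x + nsmul (Suc k) ?a" if "x \<in> S" for k x
    proof -
      have "t \<noteq> (x + nsmul k ?a) + ?a" using t that a_S by (auto simp: apery_def nsmul_nsmul add_S nsmul_S)
      then show ?thesis using nsmul_add[of k "Suc 0" ?a] by (simp add: add.assoc)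
    qed
    have upb: "w \<noteq> x + nsmul (Suc k) ?b" if "x \<in> S" "w \<in> apery d e" for k x w
    proof -
      have "w \<noteq> (x + nsmul k ?b) + ?b" using that b_S by (auto simp: apery_def nsmul_nsmul add_S nsmul_S)
      then show ?thesis using nsmul_add[of k "Suc 0" ?b] by (simp add: add.assoc)
    qed
    show ?thesis
    proof (cases "g s \<le> g t")
      case True
      then obtain l where l: "g t = g s + K * l" using cong(2) by (metis mod_eq_nat2E)
      have "nsmul K t = nsmul K (s + nsmul k ?a + nsmul l ?b)"
        unfolding fg[OF S(2)] k l nsmul_add nsmul_add_right fg[OF S(1)] by (simp add: nsmul_nsmul ac_simps)
      then have t_eq: "t = s + nsmul k ?a + nsmul l ?b" using K by (simp add: nsmul_cancel)
      have "l = 0"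
      proof (cases l)
        case (Suc l')
        then show ?thesis
          using upb[of "s + nsmul k ?a" t l'] t t_eq S a_S by (simp add: nsmul_nsmul add_S nsmul_S)
      qed
      moreover have "k = 0"
      proof (cases k)
        case (Suc k')
        then show ?thesis using up[of s k'] S t_eq \<open>l = 0\<close> by simp
      qed
      ultimately show ?thesis using t_eq by simp
    next
      \<comment> \<open>The coordinates now differ in opposite directions. From
        \<open>t + l (e b) = s + k (d a)\<close> the criterion subtracts \<open>k (d a)\<close> from
        \<open>t\<close>, which the Apery property forbids unless \<open>k = 0\<close>; then
        \<open>s\<close> exceeds \<open>t\<close> by a positive multiple of
        \<open>e b\<close>.\<close>
      case False
      then obtain l where l: "g s = g t + K * l" using cong(2) by (metis mod_eq_nat2E nat_le_linear)
      have "nsmul K (t + nsmul l ?b) = nsmul K (s + nsmul k ?a)"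
        unfolding nsmul_add_right fg[OF S(1)] fg[OF S(2)] k l nsmul_add by (simp add: nsmul_nsmul ac_simps)
      then have st: "t + nsmul l ?b = s + nsmul k ?a" using K by (simp add: nsmul_cancel)
      have "k = 0"
      proof (cases k)
        case (Suc k')
        have "t + nsmul (l * e) b = s + nsmul (k * d) a" using st by (simp add: nsmul_nsmul)
        then obtain x where "x \<in> S" "t = x + nsmul (k * d) a" using criterion S by blast
        then show ?thesis using up[of x k'] Suc by (simp add: nsmul_nsmul)
      qed
      moreover obtain l' where "l = Suc l'" using l False by (cases l) auto
      ultimately show ?thesis using upb[of t s l'] S s st by simp
    qed
  qed
  have "inj_on (\<lambda>s. (f s mod K, g s mod K)) (apery d e)"
  proof (rule inj_onI)
    fix s t assume "s \<in> apery d e" "t \<in> apery d e" "(f s mod K, g s mod K) = (f t mod K, g t mod K)"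
    then show "s = t" using key[of s t] key[of t s] by (cases "f s \<le> f t") auto
  qed
  moreover have "(\<lambda>s. (f s mod K, g s mod K)) ` apery d e \<subseteq> {..<K} \<times> {..<K}" using K by auto
  ultimately show ?thesis by (rule inj_on_finite) simp
qed

lemma apery_decomposition:
  "s \<in> S \<Longrightarrow> \<exists>w\<in>apery 1 1. \<exists>i j. s = w + nsmul i a + nsmul j b"
proof (induction "fst s + snd s" arbitrary: s rule: less_induct)
  case less
  show ?case
  proof (cases "s \<in> apery 1 1")
    case True
    then show ?thesis by (intro bexI[of _ s] exI[of _ 0]) auto
  next
    case False
    then consider x where "x \<in> S" "s = x + a" | x where "x \<in> S" "s = x + b"
      using less.prems by (auto simp: apery_def)
    then show ?thesis
    proof cases
      case 1
      then have "fst x + snd x < fst s + snd s" using a_nz by (cases a) (auto simp: zero_prod_def)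
      then obtain w i j where "w \<in> apery 1 1" "x = w + nsmul i a + nsmul j b" using less.hyps 1 by blast
      then show ?thesis using 1 nsmul_add[of i "Suc 0" a]
        by (intro bexI[of _ w] exI[of _ "Suc i"] exI[of _ j]) (auto simp: ac_simps)
    next
      case 2
      then have "fst x + snd x < fst s + snd s" using b_nz by (cases b) (auto simp: zero_prod_def)
      then obtain w i j where "w \<in> apery 1 1" "x = w + nsmul i a + nsmul j b" using less.hyps 2 by blast
      then show ?thesis using 2 nsmul_add[of j "Suc 0" b]
        by (intro bexI[of _ w] exI[of _ i] exI[of _ "Suc j"]) (auto simp: ac_simps)
    qed
  qed
qed

lemma affine_semigroup_S: "affine_semigroup S"
  unfolding affine_semigroup_def
proof (intro exI conjI)
  let ?P = "\<lambda>M. 0 \<in> M \<and> (\<forall>x\<in>M. \<forall>y\<in>M. x + y \<in> M)"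
  let ?A = "insert a (insert b (apery 1 1))"
  show "finite ?A" by (simp add: finite_apery)
  have gen: "s \<in> M" if M: "?P M" "?A \<subseteq> M" and s: "s \<in> S" for M s
  proof -
    interpret M: exponent_monoid M using M by unfold_locales auto
    obtain w i j where "w \<in> apery 1 1" "s = w + nsmul i a + nsmul j b"
      using apery_decomposition[OF s] by blast
    then show ?thesis using M(2) by (auto intro!: M.add_S M.nsmul_S)
  qed
  show "S = ?P hull ?A"
  proof
    show "S \<subseteq> ?P hull ?A" using gen unfolding hull_def by blast
    show "?P hull ?A \<subseteq> S"
      using a_S b_S zero_S add_S by (intro hull_minimal) (auto simp: apery_def)
  qed
qed

end


section \<open>Finite generation of ideals and regular sequences\<close>

context cm_monoid
begin

text \<open>Hilbert's basis argument by leading exponents. The set \<open>T\<close> of leading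
  exponents of \<open>I\<close> splits into finitely many pieces, one for each Apery element
  \<open>w\<close>, and Dickson's lemma gives finitely many minimal members in each. Polynomials of
  \<open>I\<close> with these leading exponents generate \<open>I\<close>: a nonzero remainder would
  lie in \<open>I\<close> and have its leading exponent in \<open>T\<close>, which reduction has
  removed.\<close>

lemma noetherian_supported: "noetherian_ring (subring_of (supported :: 'k::field poly2 set))"
proof -
  let ?C = "supported :: 'k poly2 set"
  interpret R: cring "subring_of ?C" by (rule cring_R)
  show ?thesis
  proof (rule R.noetherian_ringI)
    fix I assume I: "ideal I (subring_of ?C)"
    then have I_C: "I \<subseteq> ?C" and I_mult: "\<And>c x. c \<in> ?C \<Longrightarrow> x \<in> I \<Longrightarrow> c * x \<in> I"
      by (auto simp: ideal_R_iff)
    define T where "T = {s. \<exists>h\<in>I. leading h s}"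
    have T_S: "T \<subseteq> S" using I_C by (auto simp: T_def leading_def supported_def)
    let ?e = "\<lambda>w i j. w + nsmul i a + nsmul j b"
    have "\<forall>w. \<exists>F. finite F \<and> (\<forall>k l. (k, l) \<in> F \<longrightarrow> ?e w k l \<in> T) \<and>
        (\<forall>i j. ?e w i j \<in> T \<longrightarrow> (\<exists>k l. (k, l) \<in> F \<and> k \<le> i \<and> l \<le> j))"
      by (intro allI dickson_nat_pairs)
    then obtain F where F: "\<And>w. finite (F w)" "\<And>w k l. (k, l) \<in> F w \<Longrightarrow> ?e w k l \<in> T"
      "\<And>w i j. ?e w i j \<in> T \<Longrightarrow> \<exists>k l. (k, l) \<in> F w \<and> k \<le> i \<and> l \<le> j"
      by metis
    define E where "E = (\<Union>w\<in>apery 1 1. (\<lambda>(k, l). ?e w k l) ` F w)"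
    have E: "finite E" "E \<subseteq> T" using F finite_apery by (auto simp: E_def)
    have E_gen: "\<exists>t\<in>E. \<exists>x\<in>S. s = x + t" if s: "s \<in> T" for s
    proof -
      obtain w i j where w: "w \<in> apery 1 1" "s = ?e w i j"
        using apery_decomposition[of s] s T_S by blast
      then obtain k l where kl: "(k, l) \<in> F w" "k \<le> i" "l \<le> j" using F(3)[of w i j] s by auto
      have "nsmul i a = nsmul (i - k) a + nsmul k a" "nsmul j b = nsmul (j - l) b + nsmul l b"
        using kl(2,3) by (simp_all flip: nsmul_add)
      then have "s = (nsmul (i - k) a + nsmul (j - l) b) + ?e w k l" using w(2) by (simp add: ac_simps)
      moreover have "?e w k l \<in> E" using w kl by (force simp: E_def)
      moreover have "nsmul (i - k) a + nsmul (j - l) b \<in> S" using a_S b_S by (intro add_S nsmul_S)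
      ultimately show ?thesis by blast
    qed
    obtain h where h: "\<And>t. t \<in> E \<Longrightarrow> h t \<in> I \<and> leading (h t) t"
    proof -
      have "\<forall>t\<in>E. \<exists>g. g \<in> I \<and> leading g t" using E(2) by (auto simp: T_def)
      then have "\<exists>h. \<forall>t\<in>E. h t \<in> I \<and> leading (h t) t" by (rule bchoice)
      then show ?thesis using that by blast
    qed
    let ?J = "genideal (subring_of ?C) (h ` E)"
    have hC: "h ` E \<subseteq> carrier (subring_of ?C)" using h I_C by auto
    have J: "ideal ?J (subring_of ?C)" "h ` E \<subseteq> ?J"
      using R.genideal_ideal[OF hC] R.genideal_self[OF hC] by auto
    have J_I: "?J \<subseteq> I" using h by (intro genideal_R_least[OF I]) auto
    have "I \<subseteq> ?J"
    proof
      fix r assume r: "r \<in> I"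
      then have "keys r \<subseteq> S" using I_C by (auto simp: supported_def)
      moreover have "\<exists>g\<in>?J. leading g s \<and> keys g \<subseteq> S" if s: "s \<in> S" "s \<notin> - T" for s
      proof -
        obtain t x where t: "t \<in> E" "x \<in> S" "s = x + t" using E_gen s by blast
        have "single x 1 * h t \<in> ?J"
          using J t supported_single[OF t(2)] unfolding ideal_R_iff by blast
        moreover have "leading (single x 1 * h t) s"
          using h t by (simp add: leading_mult leading_single)
        moreover have "keys (single x 1 * h t) \<subseteq> S"
          using supported_mult[OF supported_single[OF t(2)], of "h t" 1] h[OF t(1)] I_C
          by (auto simp: supported_def)
        ultimately show ?thesis by blast
      qed
      ultimately obtain r' where r': "keys r' \<subseteq> - T \<inter> S" "r - r' \<in> ?J"
        using reduction'[OF ideal_subspace[OF J(1)], of S "- T" r] by blast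
      have "r' = 0"
      proof (rule ccontr)
        assume "r' \<noteq> 0"
        then obtain s where s: "leading r' s" using leading_exists by blast
        have "r + single 0 (- 1) * (r - r') \<in> I"
          using ideal_subspace[OF I] r r'(2) J_I unfolding poly_subspace_def by blast
        also have "r + single 0 (- 1) * (r - r') = r'"
          by (simp add: single_uminus)
        finally have "s \<in> T" using s by (auto simp: T_def)
        then show False using s r'(1) by (auto simp: leading_def)
      qed
      then show "r \<in> ?J" using r'(2) by simp
    qed
    then show "\<exists>A\<subseteq>carrier (subring_of ?C). finite A \<and> I = genideal (subring_of ?C) A"
      using hC E(1) J_I by (intro exI[of _ "h ` E"]) auto
  qed
qed

text \<open>The polynomial ring in the single monomial \<open>t^s\<close>.\<close>

definition axis :: "nat \<times> nat \<Rightarrow> 'k::field poly2 set"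
  where "axis s = {f. keys f \<subseteq> Set.range (\<lambda>i. nsmul i s)}"

lemma axis_supported: "s \<in> S \<Longrightarrow> f \<in> axis s \<Longrightarrow> f \<in> supported"
  using nsmul_S unfolding axis_def supported_def by blast

lemma axis_power: "f \<in> axis s \<Longrightarrow> f ^ n \<in> axis s"
proof (induction n)
  case 0
  have "(0 :: nat \<times> nat) = nsmul 0 s" by simp
  then show ?case by (auto simp: axis_def simp del: nsmul_0)
next
  case (Suc n)
  show ?case unfolding axis_def
  proof (rule, rule)
    fix t assume "t \<in> keys (f ^ Suc n)"
    then obtain x y where "t = x + y" "x \<in> keys f" "y \<in> keys (f ^ n)" using keys_mult[of f "f ^ n"] by auto
    then obtain i j where "t = nsmul i s + nsmul j s" using Suc by (fastforce simp: axis_def)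
    then have "t = nsmul (i + j) s" by (simp add: nsmul_add)
    then show "t \<in> Set.range (\<lambda>i. nsmul i s)" by blast
  qed
qed

lemma leading_axis:
  assumes "f \<in> axis s" "f \<noteq> 0"
  obtains k where "leading f (nsmul k s)"
  using leading_exists[OF assms(2)] assms(1) unfolding axis_def leading_def by blast

text \<open>Polynomials in \<open>t\<^sup>a\<close> and in \<open>t\<^sup>b\<close> form regular sequences: divide \<open>c\<close> by \<open>u\<close> with a remainder
  supported outside \<open>k a + S\<close>, where \<open>k a\<close> is the leading exponent of \<open>u\<close>. By the criterion the
  complement of \<open>k a + S\<close> in \<open>S\<close> is stable under adding \<open>b\<close>, so \<open>v\<close> times the remainder, being
  divisible by \<open>u\<close>, vanishes.\<close>

lemma axis_coprime:
  fixes u v c d :: "'k::field poly2"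
  assumes u: "u \<in> axis a" "u \<noteq> 0" and v: "v \<in> axis b" "v \<noteq> 0"
    and c: "c \<in> supported" "d \<in> supported" "v * c = u * d"
  shows "\<exists>e\<in>supported. c = u * e"
proof -
  have uC: "u \<in> supported" and vC: "v \<in> supported" using u v a_S b_S axis_supported by blast+
  obtain k where k: "leading u (nsmul k a)" using u by (rule leading_axis)
  let ?M = "{s \<in> S. \<forall>x\<in>S. s \<noteq> x + nsmul k a}"
  let ?W = "(\<lambda>e. u * e) ` (supported :: 'k poly2 set)"
  have "poly_subspace ?W"
    unfolding poly_subspace_def
  proof (intro conjI ballI allI)
    show "0 \<in> ?W" using zero_mem by force
    show "f + g \<in> ?W" if fg: "f \<in> ?W" "g \<in> ?W" for f g
    proof -
      obtain e e' where "e \<in> supported" "e' \<in> supported" "f = u * e" "g = u * e'" using fg by blast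
      then have "f + g = u * (e + e')" "e + e' \<in> supported"
        using supported_add by (auto simp: algebra_simps)
      then show ?thesis by blast
    qed
    show "single 0 c * f \<in> ?W" if f: "f \<in> ?W" for c f
    proof -
      obtain e where "e \<in> supported" "f = u * e" using f by blast
      then have "single 0 c * f = u * (single 0 c * e)" "single 0 c * e \<in> supported"
        by (simp_all add: supported_mult supported_single zero_S ac_simps)
      then show ?thesis by blast
    qed
  qed
  moreover have "\<exists>h\<in>?W. leading h s \<and> keys h \<subseteq> S" if s: "s \<in> S" "s \<notin> ?M" for s
  proof -
    obtain x where x: "x \<in> S" "s = nsmul k a + x" using s by (auto simp: add.commute)
    have "leading (u * single x 1) s" using k x by (simp add: leading_mult leading_single)
    moreover have "keys (u * single x 1) \<subseteq> S"
      using supported_mult[OF uC supported_single[OF x(1)], of 1] by (simp add: supported_def)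
    ultimately show ?thesis using supported_single[OF x(1)] by blast
  qed
  moreover have "keys c \<subseteq> S" using c by (simp add: supported_def)
  ultimately have "\<exists>r. keys r \<subseteq> ?M \<inter> S \<and> c - r \<in> ?W" by (rule reduction')
  then obtain r e where r: "keys r \<subseteq> ?M" and e: "e \<in> supported" "c - r = u * e" by auto
  have rC: "r \<in> supported" using r by (auto simp: supported_def)
  let ?t = "d - v * e"
  have "v * r = v * c - v * (c - r)" by (simp add: algebra_simps)
  also have "\<dots> = u * ?t" unfolding e(2) c(3) by (simp add: algebra_simps)
  finally have vr: "v * r = u * ?t" .
  have tC: "?t \<in> supported" using c e vC by (simp add: mem)
  \<comment> \<open>Otherwise the leading exponent \<open>k a + s\<close> of \<open>u * ?t\<close>
    occurs in \<open>v * r\<close> as \<open>j b + y\<close> with \<open>y\<close> an exponent of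
    the remainder, and the criterion would put \<open>y\<close> into \<open>k a + S\<close>.\<close>
  have "?t = 0"
  proof (rule ccontr)
    assume "?t \<noteq> 0"
    then obtain s where s: "leading ?t s" using leading_exists by blast
    then have "leading (v * r) (nsmul k a + s)" unfolding vr using k by (intro leading_mult)
    then obtain x y where xy: "nsmul k a + s = x + y" "x \<in> keys v" "y \<in> keys r"
      using keys_mult[of v r] by (auto simp: leading_def)
    obtain j where j: "x = nsmul j b" using xy(2) v(1) by (auto simp: axis_def)
    have "s \<in> S" using s tC by (auto simp: leading_def supported_def)
    moreover have "y \<in> S" using xy(3) r by auto
    moreover have "y + nsmul j b = s + nsmul k a" using xy(1) j by (simp add: ac_simps)
    ultimately have "\<exists>x\<in>S. y = x + nsmul k a" by (intro criterion)
    then show False using xy(3) r by auto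
  qed
  then have "v * r = 0" using vr by simp
  then have "r = 0" using poly2_no_zero_div v(2) by blast
  then show ?thesis using e by auto
qed

text \<open>Eliminating \<open>y\<close> from the two relations and cancelling \<open>x\<close>
  gives \<open>v * c = u * d\<close>. So \<open>u\<close> divides \<open>c\<close>, and cancelling
  \<open>u\<close> in \<open>u * y = c * x\<close> gives the claim.\<close>

lemma axis_regular:
  fixes u v x y :: "'k::field poly2"
  assumes u: "u \<in> axis a" "u \<noteq> 0" and v: "v \<in> axis b" "v \<noteq> 0"
    and xy: "x \<in> supported" "y \<in> supported" "x \<noteq> 0"
    and c: "c \<in> supported" "u * y = c * x" and d: "d \<in> supported" "v * y = d * x"
  shows "\<exists>e\<in>supported. y = e * x"
proof -
  have "(v * c - u * d) * x = v * (c * x) - u * (d * x)" by (simp add: algebra_simps)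
  also have "\<dots> = v * (u * y) - u * (v * y)" unfolding c(2) d(2) ..
  also have "\<dots> = 0" by (simp add: ac_simps)
  finally have "v * c = u * d" using poly2_no_zero_div xy(3) by fastforce
  then obtain e where e: "e \<in> supported" "c = u * e" using axis_coprime[OF u v c(1) d(1)] by blast
  have "u * (y - e * x) = 0" using c(2) e(2) by (simp add: algebra_simps)
  then have "y = e * x" using poly2_no_zero_div u(2) by fastforce
  then show ?thesis using e by blast
qed

end


section \<open>Counting monomials modulo a prime, and chains of primes\<close>

lemma leading_power:
  fixes f :: "'k::field poly2"
  assumes "leading f e"
  shows "leading (f ^ n) (nsmul n e)"
proof (induction n)
  case 0
  show ?case using leading_single[of "1 :: 'k" 0] by simp
next
  case (Suc n)
  then show ?case using leading_mult[OF assms Suc] nsmul_add[of "Suc 0" n e] by simp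
qed

lemma keys_mult_degree:
  assumes "\<forall>s\<in>keys f. fst s + snd s \<le> m" "\<forall>s\<in>keys g. fst s + snd s \<le> n"
  shows "\<forall>s\<in>keys (f * g :: 'k::field poly2). fst s + snd s \<le> m + n"
proof
  fix s assume "s \<in> keys (f * g)"
  then obtain x y where "s = x + y" "x \<in> keys f" "y \<in> keys g" using keys_mult by blast
  then show "fst s + snd s \<le> m + n" using assms by fastforce
qed

context cm_monoid
begin

text \<open>An element \<open>w + i a + j b\<close> outside \<open>E + S\<close> has
  \<open>i < i0\<close> or \<open>j < j0\<close>. The other coefficient is at most \<open>n\<close>,
  as \<open>a\<close> and \<open>b\<close> have degree at least 1, so the count is linear in
  \<open>n\<close>.\<close>

lemma card_low_degree:
  assumes E: "E = nsmul i0 a + nsmul j0 b"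
  shows "finite {s \<in> S. (\<forall>x\<in>S. s \<noteq> x + E) \<and> fst s + snd s \<le> n}"
    and "card {s \<in> S. (\<forall>x\<in>S. s \<noteq> x + E) \<and> fst s + snd s \<le> n} \<le>
      card (apery 1 1) * (i0 + j0) * Suc n" (is "card ?B \<le> _")
proof -
  let ?g = "\<lambda>(w, i, j). w + nsmul i a + nsmul j b"
  let ?X = "{..<i0} \<times> {..n} \<union> {..n} \<times> {..<j0}"
  have sub: "?B \<subseteq> ?g ` (apery 1 1 \<times> ?X)"
  proof
    fix s assume "s \<in> ?B"
    then have s: "s \<in> S" "\<And>x. x \<in> S \<Longrightarrow> s \<noteq> x + E" "fst s + snd s \<le> n" by blast+
    obtain w i j where w: "w \<in> apery 1 1" "s = w + nsmul i a + nsmul j b"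
      using apery_decomposition[OF s(1)] by blast
    have "1 \<le> fst a + snd a" "1 \<le> fst b + snd b" using a_nz b_nz by (auto simp: prod_eq_iff)
    then have "i * 1 \<le> i * (fst a + snd a)" "j * 1 \<le> j * (fst b + snd b)" by (simp_all only: mult_le_mono2)
    then have "i \<le> n" "j \<le> n" using s(3) w(2) by (auto simp: algebra_simps)
    moreover have "\<not> (i0 \<le> i \<and> j0 \<le> j)"
    proof
      assume ij: "i0 \<le> i \<and> j0 \<le> j"
      have "w + nsmul (i - i0) a + nsmul (j - j0) b \<in> S"
        using w a_S b_S by (intro add_S nsmul_S) (auto simp: apery_def)
      moreover have "s = (w + nsmul (i - i0) a + nsmul (j - j0) b) + E"
      proof -
        have "nsmul i a = nsmul (i - i0) a + nsmul i0 a" "nsmul j b = nsmul (j - j0) b + nsmul j0 b"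
          using ij by (simp_all flip: nsmul_add)
        then show ?thesis using w(2) E by (simp add: ac_simps)
      qed
      ultimately show False using s(2) by blast
    qed
    ultimately have "(w, i, j) \<in> apery 1 1 \<times> ?X" using w(1) by auto
    moreover have "s = ?g (w, i, j)" using w(2) by simp
    ultimately show "s \<in> ?g ` (apery 1 1 \<times> ?X)" by (rule rev_image_eqI)
  qed
  have fin: "finite (apery 1 1 \<times> ?X)" using finite_apery by auto
  show "finite ?B" using sub fin by (meson finite_imageI finite_subset)
  have "card ?B \<le> card (?g ` (apery 1 1 \<times> ?X))" using sub fin by (intro card_mono finite_imageI)
  also have "\<dots> \<le> card (apery 1 1 \<times> ?X)" using fin by (rule card_image_le)
  also have "\<dots> = card (apery 1 1) * card ?X" by (rule card_cartesian_product)
  also have "\<dots> \<le> card (apery 1 1) * ((i0 + j0) * Suc n)"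
  proof (rule mult_le_mono2)
    have "card ?X \<le> card ({..<i0} \<times> {..n}) + card ({..n} \<times> {..<j0})" by (rule card_Un_le)
    then show "card ?X \<le> (i0 + j0) * Suc n" by (simp add: algebra_simps)
  qed
  finally show "card ?B \<le> card (apery 1 1) * (i0 + j0) * Suc n" by (simp only: mult.assoc)
qed

text \<open>The Hilbert function of \<open>K[S] / p\<close> grows at most linearly as \<open>p \<noteq> 0\<close>, while there are
  \<open>n\<^sup>2\<close> monomials of degree less than \<open>n\<close> in each of \<open>t\<^sup>a\<close> and \<open>z\<close>.\<close>

lemma algebraic_relation:
  fixes p :: "'k::field poly2 set"
  assumes p: "ideal p (subring_of supported)" and h: "h \<in> p" "h \<noteq> 0" and z: "z \<in> supported"
  shows "\<exists>n g. (\<forall>j<n. g j \<in> axis a) \<and> (\<exists>j<n. g j \<noteq> 0) \<and> (\<Sum>j<n. g j * z ^ j) \<in> p"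
proof -
  have p_C: "p \<subseteq> supported" and p_mult: "\<And>c x. c \<in> supported \<Longrightarrow> x \<in> p \<Longrightarrow> c * x \<in> p"
    using p unfolding ideal_R_iff by blast+
  obtain E0 where E0: "leading h E0" using leading_exists[OF h(2)] by blast
  have "E0 \<in> S" using E0 h(1) p_C by (auto simp: leading_def supported_def)
  then obtain i0 j0 where "nsmul D E0 = nsmul i0 a + nsmul j0 b" using cone by blast
  then obtain E where E: "E = nsmul D E0" "E = nsmul i0 a + nsmul j0 b" by simp
  \<comment> \<open>The leading exponent of \<open>h\<close> need not be a natural combination of
    \<open>a\<close> and \<open>b\<close>, but its \<open>D\<close>-fold is; hence the passage to
    the power \<open>h ^ D\<close>.\<close>
  have hD: "h ^ D \<in> p" "leading (h ^ D) E"
  proof -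
    obtain D' where D': "D = Suc D'" using D_pos by (cases D) auto
    have "h ^ D' * h \<in> p" using p_mult h(1) p_C power_mem by blast
    then show "h ^ D \<in> p" by (simp add: D' mult.commute)
    show "leading (h ^ D) E" unfolding E(1) using E0 by (rule leading_power)
  qed
  let ?M = "{s \<in> S. \<forall>x\<in>S. s \<noteq> x + E}"
  define dz where "dz = Max (insert 0 ((\<lambda>s. fst s + snd s) ` keys z))"
  have dz: "\<forall>s\<in>keys z. fst s + snd s \<le> dz" by (auto simp: dz_def intro!: Max_ge)
  have dzj: "\<forall>s\<in>keys (z ^ j). fst s + snd s \<le> j * dz" for j
  proof (induction j)
    case (Suc j)
    then show ?case using keys_mult_degree[OF dz Suc] by (simp add: add.commute)
  qed simp
  define K where "K = card (apery 1 1) * (i0 + j0)"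
  define \<delta> where "\<delta> = fst a + snd a + dz"
  \<comment> \<open>\<open>\<delta>\<close> is chosen so that the \<open>n * n\<close> products
    \<open>t^(i a) * z ^ j\<close> have degree at most \<open>n * \<delta>\<close>. There are at
    most \<open>K * Suc (n * \<delta>)\<close> remainder exponents of such degree, and this
    \<open>n\<close> makes that number less than \<open>n * n\<close>.\<close>
  define n where "n = Suc (K * Suc \<delta>)"
  let ?B = "{s \<in> S. (\<forall>x\<in>S. s \<noteq> x + E) \<and> fst s + snd s \<le> n * \<delta>}"
  define v where "v = (\<lambda>(i, j). single (nsmul i a) 1 * z ^ j)"
  have "card ?B \<le> K * Suc (n * \<delta>)" unfolding K_def by (rule card_low_degree(2)[OF E(2)])
  also have "\<dots> \<le> K * (n * Suc \<delta>)" by (intro mult_le_mono2) (simp add: n_def)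
  also have "\<dots> = n * (K * Suc \<delta>)" by (simp only: ac_simps)
  also have "\<dots> < n * n" by (simp add: n_def)
  finally have card: "card ?B < card ({..<n} \<times> {..<n})" by simp
  \<comment> \<open>\<open>(0, Suc m)\<close> is the first exponent of degree \<open>m + 1\<close>
    in the monomial order, so a bound on codes turns into a bound on degrees.\<close>
  have low: "prod_encode s < prod_encode (0, Suc m) \<longleftrightarrow> fst s + snd s \<le> m" for s m
    by (cases s) (auto simp: prod_encode_less_iff)
  have red: "\<exists>r. keys r \<subseteq> ?B \<and> v i - r \<in> p" if i: "i \<in> {..<n} \<times> {..<n}" for i
  proof -
    obtain k l where kl: "i = (k, l)" "k < n" "l < n" using i by auto
    have vS: "v i \<in> supported"
      unfolding v_def kl using z a_S by (simp add: supported_mult supported_single nsmul_S power_mem)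
    have "\<forall>s\<in>keys (single (nsmul k a) (1::'k)). fst s + snd s \<le> k * (fst a + snd a)"
      by (simp add: algebra_simps)
    then have "\<forall>s\<in>keys (v i). fst s + snd s \<le> k * (fst a + snd a) + l * dz"
      unfolding v_def kl case_prod_conv using dzj by (rule keys_mult_degree)
    moreover have "k * (fst a + snd a) + l * dz \<le> n * \<delta>"
      unfolding \<delta>_def distrib_left [of n "fst a + snd a"] using kl(2,3)
      by (intro add_mono mult_le_mono1) simp_all
    ultimately have deg: "\<forall>s\<in>keys (v i). prod_encode s < prod_encode (0, Suc (n * \<delta>))"
      unfolding low by fastforce
    have "\<exists>r. keys r \<subseteq> {s \<in> ?M \<inter> S. prod_encode s < prod_encode (0, Suc (n * \<delta>))} \<and> v i - r \<in> p"
    proof (rule reduction[OF ideal_subspace[OF p] _ _ deg])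
      show "keys (v i) \<subseteq> S" using vS by (simp add: supported_def)
      show "\<exists>g\<in>p. leading g s \<and> keys g \<subseteq> S" if s: "s \<in> S" "s \<notin> ?M" for s
      proof -
        obtain x where x: "x \<in> S" "s = x + E" using s by blast
        have "single x 1 * h ^ D \<in> p" using p_mult supported_single[OF x(1)] hD(1) by blast
        moreover have "leading (single x 1 * h ^ D) s"
          unfolding x(2) using hD(2) by (intro leading_mult leading_single) simp_all
        ultimately show ?thesis using p_C unfolding supported_def by blast
      qed
    qed
    then show ?thesis unfolding low by auto
  qed
  have "finite ({..<n} \<times> {..<n})" by simp
  then have "\<exists>c. (\<exists>i\<in>{..<n} \<times> {..<n}. c i \<noteq> 0) \<and>
      (\<Sum>i\<in>{..<n} \<times> {..<n}. single 0 (c i) * v i) \<in> p"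
    by (rule dependent_modulo[OF ideal_subspace[OF p] card_low_degree(1)[OF E(2)] _ card red])
  then obtain c where c: "\<exists>i\<in>{..<n} \<times> {..<n}. c i \<noteq> 0"
    "(\<Sum>i\<in>{..<n} \<times> {..<n}. single 0 (c i) * v i) \<in> p" by blast
  \<comment> \<open>Collects the combination by powers of \<open>z\<close>. The multiples
    \<open>i a\<close> are distinct, so no coefficient \<open>c (i, j)\<close> is lost by
    cancellation within \<open>g j\<close>.\<close>
  define g where "g j = (\<Sum>i<n. single (nsmul i a) (c (i, j)))" for j
  have inj: "nsmul i a = nsmul i' a \<longleftrightarrow> i = i'" for i i'
    using a_nz by (auto simp: prod_eq_iff)
  have "(\<Sum>j<n. g j * z ^ j) = (\<Sum>j<n. \<Sum>i<n. single 0 (c (i, j)) * v (i, j))"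
    by (simp add: g_def v_def sum_distrib_right mult_single flip: mult.assoc)
  also have "\<dots> = (\<Sum>i<n. \<Sum>j<n. single 0 (c (i, j)) * v (i, j))" by (rule sum.swap)
  also have "\<dots> = (\<Sum>i\<in>{..<n} \<times> {..<n}. single 0 (c i) * v i)"
    by (subst sum.cartesian_product) (simp add: case_prod_beta)
  finally have "(\<Sum>j<n. g j * z ^ j) \<in> p" using c(2) by simp
  moreover have "g j \<in> axis a" for j
    unfolding axis_def
  proof (rule, rule)
    fix s assume "s \<in> keys (g j)"
    then have "(\<Sum>i<n. lookup (single (nsmul i a) (c (i, j))) s) \<noteq> 0"
      by (simp add: in_keys_iff g_def lookup_sum)
    then obtain i where "lookup (single (nsmul i a) (c (i, j))) s \<noteq> 0" by (meson sum.neutral)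
    then show "s \<in> Set.range (\<lambda>i. nsmul i a)" by (auto simp: lookup_single when_def split: if_splits)
  qed
  moreover have "\<exists>j<n. g j \<noteq> 0"
  proof -
    obtain i j where ij: "i < n" "j < n" "c (i, j) \<noteq> 0" using c(1) by auto
    have "lookup (g j) (nsmul i a) = (\<Sum>i'<n. if i' = i then c (i', j) else 0)"
      by (simp add: g_def lookup_sum lookup_single inj when_def)
    then have "lookup (g j) (nsmul i a) \<noteq> 0" using ij by simp
    then have "g j \<noteq> 0" by auto
    then show ?thesis using ij by blast
  qed
  ultimately show ?thesis by blast
qed

text \<open>Used for \<open>a\<close> and, through \<open>swap\<close>, for \<open>b\<close>, it
  supplies both members of the regular sequence.\<close>

lemma ideal_meets_axis:
  fixes p q :: "'k::field poly2 set"
  assumes p: "primeideal p (subring_of supported)" "p \<noteq> {0}" and q: "ideal q (subring_of supported)" "p \<subset> q"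
  shows "\<exists>f\<in>axis a. f \<noteq> 0 \<and> f \<in> q"
proof -
  have p': "ideal p (subring_of supported)" using p by (simp add: primeideal_R_iff)
  then have "0 \<in> p" by (simp add: ideal_R_iff)
  then obtain h where h: "h \<in> p" "h \<noteq> 0" using p(2) by blast
  obtain z where z: "z \<in> q" "z \<notin> p" using q(2) by blast
  have zC: "z \<in> supported" using z(1) q(1) by (auto simp: ideal_R_iff)
  obtain n g where g: "\<forall>j<n. g j \<in> axis a" "\<exists>j<n. g j \<noteq> 0" "(\<Sum>j<n. g j * z ^ j) \<in> p"
    using algebraic_relation[OF p' h zC] by blast
  have "p \<subseteq> q" "axis a \<subseteq> (supported :: 'k poly2 set)"
    using q(2) axis_supported[OF a_S] by blast+
  then show ?thesis
    using g by (intro constant_term_of_relation[OF p(1) q(1) _ z, of "axis a" n g]) blast+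
qed

text \<open>Once \<open>q\<close> contains nonzero polynomials in \<open>t^a\<close> and in
  \<open>t^b\<close>, a finite Apery set spans the ring modulo \<open>q\<close>. The powers of any
  \<open>z\<close> in \<open>r\<close> but not in \<open>q\<close> are then dependent modulo
  \<open>q\<close> over the field, which puts a nonzero constant into \<open>r\<close>.\<close>

lemma no_long_chain:
  fixes p q r :: "'k::field poly2 set"
  assumes p: "primeideal p (subring_of supported)" "p \<noteq> {0}" and q: "primeideal q (subring_of supported)" "p \<subset> q"
    and r: "primeideal r (subring_of supported)" "q \<subset> r"
  shows False
proof -
  interpret sw: cm_monoid S b a D by (rule swap)
  have q': "ideal q (subring_of supported)" using q by (simp add: primeideal_R_iff)
  have r': "ideal r (subring_of supported)" "r \<noteq> supported" using r by (simp_all add: primeideal_R_iff)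
  have q_C: "q \<subseteq> supported" and q_mult: "\<And>c x. c \<in> supported \<Longrightarrow> x \<in> q \<Longrightarrow> c * x \<in> q"
    using q' unfolding ideal_R_iff by blast+
  obtain f where f: "f \<in> axis a" "f \<noteq> 0" "f \<in> q" using ideal_meets_axis[OF p q' q(2)] by blast
  obtain g where g: "g \<in> axis b" "g \<noteq> 0" "g \<in> q" using sw.ideal_meets_axis[OF p q' q(2)] by blast
  obtain k where k: "leading f (nsmul k a)" using f(1,2) by (rule leading_axis)
  obtain l where l: "leading g (nsmul l b)" using g(1,2) by (rule leading_axis)
  have red: "\<exists>h\<in>q. leading h s \<and> keys h \<subseteq> S" if s: "s \<in> S" "s \<notin> apery k l" for s
  proof -
    have *: ?thesis if "x \<in> S" "s = x + e" "leading f e" "f \<in> q" for x e f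
    proof -
      have "single x 1 * f \<in> q" using q_mult supported_single that by blast
      moreover have "leading (single x 1 * f) s"
        using that by (simp add: leading_mult leading_single)
      ultimately show ?thesis using q_C unfolding supported_def by blast
    qed
    obtain x where "x \<in> S" "s = x + nsmul k a \<or> s = x + nsmul l b"
      using s unfolding apery_def by blast
    then show ?thesis using *[OF _ _ k f(3)] *[OF _ _ l g(3)] by blast
  qed
  obtain z where z: "z \<in> r" "z \<notin> q" using r(2) by blast
  have zC: "z \<in> supported" using z(1) r'(1) by (auto simp: ideal_R_iff)
  define n where "n = Suc (card (apery k l))"
  have "\<exists>h. keys h \<subseteq> apery k l \<and> z ^ i - h \<in> q" for i
  proof -
    have "keys (z ^ i) \<subseteq> S" using power_mem[OF zC, of i] by (simp add: supported_def)
    then have "\<exists>h. keys h \<subseteq> apery k l \<inter> S \<and> z ^ i - h \<in> q"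
      using red by (intro reduction'[OF ideal_subspace[OF q']])
    then show ?thesis by blast
  qed
  then obtain c where c: "\<exists>i\<in>{..<n}. c i \<noteq> 0" "(\<Sum>i<n. single 0 (c i) * z ^ i) \<in> q"
    using dependent_modulo[OF ideal_subspace[OF q'] finite_apery, of "{..<n}" k l "\<lambda>i. z ^ i"]
    by (auto simp: n_def)
  have "\<exists>f\<in>Set.range (single 0). f \<noteq> 0 \<and> f \<in> r"
  proof (rule constant_term_of_relation[OF q(1) r'(1) _ z])
    show "\<exists>j<n. single 0 (c j) \<noteq> 0" using c(1) by (metis lessThan_iff lookup_single_eq lookup_zero)
  qed (use c r(2) supported_single[OF zero_S] in auto)
  then obtain d where d: "single 0 d \<in> r" "single 0 d \<noteq> (0 :: 'k poly2)" by blast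
  then have "d \<noteq> 0" by auto
  then have "x = (x * single 0 (inverse d)) * single 0 d" for x
    by (simp add: mult.assoc mult_single)
  moreover have "(x * single 0 (inverse d)) * single 0 d \<in> r" if "x \<in> supported" for x
    using r'(1) d(1) that supported_mult supported_single zero_S unfolding ideal_R_iff by blast
  ultimately have "supported \<subseteq> r" by (metis subsetI)
  then show False using r' by (auto simp: ideal_R_iff)
qed

theorem buchsbaum_supported: "buchsbaum_ring (subring_of (supported :: 'k::field poly2 set))"
proof (rule buchsbaum_ringI[OF noetherian_supported])
  interpret sw: cm_monoid S b a D by (rule swap)
  fix m p q :: "'k poly2 set"
  assume p: "primeideal p (subring_of supported)" "p \<noteq> {0}"
    and q: "primeideal q (subring_of supported)" "p \<subset> q" and m: "q \<subseteq> m"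
  have q': "ideal q (subring_of supported)" using q by (simp add: primeideal_R_iff)
  obtain u where u: "u \<in> axis a" "u \<noteq> 0" "u \<in> q" using ideal_meets_axis[OF p q' q(2)] by blast
  obtain v where v: "v \<in> axis b" "v \<noteq> 0" "v \<in> q" using sw.ideal_meets_axis[OF p q' q(2)] by blast
  have pow: "u ^ i \<noteq> 0" "v ^ i \<noteq> 0" for i
    using power_nonzero u v axis_supported a_S b_S by blast+
  have "\<exists>c\<in>supported. y = c * x"
    if "x \<in> supported" "y \<in> supported" "x \<noteq> 0"
      "\<exists>c\<in>supported. u ^ i * y = c * x" "\<exists>c\<in>supported. v ^ j * y = c * x" for i j x y
    using that axis_regular[OF axis_power[OF u(1)] pow(1) axis_power[OF v(1)] pow(2)] by blast
  then show "\<exists>u\<in>m. \<exists>v\<in>m. u \<noteq> 0 \<and> (\<forall>i j x y. x \<in> supported \<longrightarrow> y \<in> supported \<longrightarrow> x \<noteq> 0 \<longrightarrow>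
        (\<exists>c\<in>supported. u ^ i * y = c * x) \<longrightarrow> (\<exists>c\<in>supported. v ^ j * y = c * x) \<longrightarrow>
        (\<exists>c\<in>supported. y = c * x))"
    using u v m by (intro bexI[of _ u] bexI[of _ v]) auto
qed (rule no_long_chain)

theorem buchsbaum_semigroup_S: "buchsbaum_semigroup TYPE('k::field) S"
  using affine_semigroup_S buchsbaum_supported
  by (simp add: buchsbaum_semigroup_def semigroup_ring_eq)

end


section \<open>Plane geometry of polygonal semigroups\<close>

text \<open>The oriented area: for \<open>det2 a b > 0\<close>, the cone from \<open>a\<close>
  counterclockwise to \<open>b\<close> is described by \<open>0 \<le> det2 a x\<close> and
  \<open>0 \<le> det2 x b\<close>.\<close>

definition det2 :: "real \<times> real \<Rightarrow> real \<times> real \<Rightarrow> real"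
  where "det2 x y = fst x * snd y - snd x * fst y"

lemma det2_simps:
  "det2 (x + x') y = det2 x y + det2 x' y" "det2 y (x + x') = det2 y x + det2 y x'"
  "det2 (x - x') y = det2 x y - det2 x' y" "det2 y (x - x') = det2 y x - det2 y x'"
  "det2 (c *\<^sub>R x) y = c * det2 x y" "det2 y (c *\<^sub>R x) = c * det2 y x"
  "det2 x x = 0" "det2 0 x = 0" "det2 x 0 = 0"
  by (simp_all add: det2_def algebra_simps)

lemma det2_commute: "det2 x y = - det2 y x"
  by (simp add: det2_def)

lemma det2_cramer: "det2 a b *\<^sub>R x = det2 x b *\<^sub>R a + det2 a x *\<^sub>R b"
  by (simp add: det2_def prod_eq_iff algebra_simps)

lemma det2_decompose:
  assumes "det2 a b \<noteq> 0"
  shows "x = (det2 x b / det2 a b) *\<^sub>R a + (det2 a x / det2 a b) *\<^sub>R b"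
proof -
  have "x = (1 / det2 a b) *\<^sub>R (det2 a b *\<^sub>R x)" using assms by simp
  also have "\<dots> = (1 / det2 a b) *\<^sub>R (det2 x b *\<^sub>R a + det2 a x *\<^sub>R b)" by (rule arg_cong[OF det2_cramer])
  finally show ?thesis by (simp add: scaleR_add_right)
qed

definition quadrant :: "(real \<times> real) set"
  where "quadrant = {x. 0 \<le> fst x \<and> 0 \<le> snd x}"

lemma convex_linear_ge: "linear f \<Longrightarrow> convex {x. (c::real) \<le> f x}"
  using convex_linear_vimage[of f "{c..}"] by (simp add: vimage_def)

lemma linear_det2: "linear (\<lambda>x. det2 x y)" "linear (det2 y)"
  by (rule linearI; simp add: det2_simps)+

lemma convex_quadrant: "convex quadrant"
proof -
  have "quadrant = {x. 0 \<le> fst x} \<inter> {x. 0 \<le> snd x}" by (auto simp: quadrant_def)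
  moreover have "convex \<dots>"
    by (intro convex_Int convex_linear_ge bounded_linear.linear bounded_linear_fst bounded_linear_snd)
  ultimately show ?thesis by simp
qed

lemma scaled_add:
  assumes "convex F" "f \<in> F" "g \<in> F" "0 \<le> s" "0 \<le> t"
  shows "\<exists>h\<in>F. s *\<^sub>R f + t *\<^sub>R g = (s + t) *\<^sub>R h"
proof (cases "s + t = 0")
  case True
  then have "s = 0" "t = 0" using assms by auto
  then show ?thesis using assms by auto
next
  case False
  have "(s / (s + t)) *\<^sub>R f + (t / (s + t)) *\<^sub>R g \<in> F"
    using assms False by (intro convexD) (auto simp: add_divide_distrib [symmetric])
  then show ?thesis using False
    by (intro bexI[of _ "(s / (s + t)) *\<^sub>R f + (t / (s + t)) *\<^sub>R g"]) (auto simp: scaleR_add_right)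
qed

section \<open>From integer points of multiples of a convex set to the monoid conditions\<close>

definition multiples :: "(real \<times> real) set \<Rightarrow> (real \<times> real) set"
  where "multiples F = (\<Union>i::nat. (\<lambda>x. real i *\<^sub>R x) ` F)"

lemma mem_multiples: "x \<in> multiples F \<longleftrightarrow> (\<exists>i f. f \<in> F \<and> x = real i *\<^sub>R f)"
  unfolding multiples_def image_def by blast

lemma polygonal_semigroup_iff: "s \<in> polygonal_semigroup F \<longleftrightarrow> real_point s \<in> multiples F"
  by (simp add: polygonal_semigroup_def multiples_def)

lemma real_point_add: "real_point (s + t) = real_point s + real_point t"
  by (simp add: real_point_def)

lemma real_point_nsmul: "real_point (nsmul n s) = real n *\<^sub>R real_point s"
  by (simp add: real_point_def)

lemma real_point_eq_iff: "real_point s = real_point t \<longleftrightarrow> s = t"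
  by (simp add: real_point_def prod_eq_iff)

lemma real_point_0: "real_point 0 = 0"
  by (simp add: real_point_def prod_eq_iff)

lemma exponent_monoid_polygonal:
  assumes F: "convex F" "F \<noteq> {}"
  shows "exponent_monoid (polygonal_semigroup F)"
proof
  obtain f where "f \<in> F" using F by blast
  then show "0 \<in> polygonal_semigroup F"
    unfolding polygonal_semigroup_iff mem_multiples real_point_0
    by (intro exI[of _ 0] exI[of _ f]) simp
  fix s t assume "s \<in> polygonal_semigroup F" "t \<in> polygonal_semigroup F"
  then obtain i f j g where h: "f \<in> F" "g \<in> F" "real_point s = real i *\<^sub>R f" "real_point t = real j *\<^sub>R g"
    unfolding polygonal_semigroup_iff mem_multiples by blast
  then obtain h where "h \<in> F" "real i *\<^sub>R f + real j *\<^sub>R g = (real i + real j) *\<^sub>R h"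
    using scaled_add[OF F(1)] by (metis of_nat_0_le_iff)
  then show "s + t \<in> polygonal_semigroup F"
    unfolding polygonal_semigroup_iff mem_multiples real_point_add h(3,4)
    by (intro exI[of _ "i + j"] exI[of _ h]) simp
qed

text \<open>Cramer's rule gives the common denominator \<open>D = det2 a b\<close>, since the
  numerators are integers. The criterion is thereby reduced to a statement about real points of the
  cone.\<close>

lemma cm_monoid_polygonal:
  assumes F: "convex F" "F \<subseteq> quadrant"
    and ab: "a \<in> polygonal_semigroup F" "b \<in> polygonal_semigroup F" "0 < det2 (real_point a) (real_point b)"
    and cone: "\<And>x. x \<in> F \<Longrightarrow> 0 \<le> det2 (real_point a) x \<and> 0 \<le> det2 x (real_point b)"
    and crit: "\<And>x i j. 0 \<le> det2 (real_point a) x \<Longrightarrow> 0 \<le> det2 x (real_point b) \<Longrightarrow>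
      x + real i *\<^sub>R real_point a \<in> multiples F \<Longrightarrow> x + real j *\<^sub>R real_point b \<in> multiples F \<Longrightarrow>
      x \<in> multiples F"
  shows "\<exists>D. cm_monoid (polygonal_semigroup F) a b D"
proof -
  have "F \<noteq> {}" using ab(1) unfolding polygonal_semigroup_iff mem_multiples by blast
  then interpret exponent_monoid "polygonal_semigroup F"
    using F by (intro exponent_monoid_polygonal)
  let ?A = "real_point a" and ?B = "real_point b"
  have cone': "0 \<le> det2 ?A (real_point s)" "0 \<le> det2 (real_point s) ?B"
    if s: "s \<in> polygonal_semigroup F" for s
  proof -
    obtain i f where f: "f \<in> F" "real_point s = real i *\<^sub>R f"
      using s unfolding polygonal_semigroup_iff mem_multiples by blast
    show "0 \<le> det2 ?A (real_point s)" "0 \<le> det2 (real_point s) ?B"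
      unfolding f(2) using cone[OF f(1)] by (simp_all add: det2_simps)
  qed
  \<comment> \<open>Truncated subtraction is harmless: the determinants in question are nonnegative
    on the cone.\<close>
  define \<Delta> where "\<Delta> = (\<lambda>s t. fst s * snd t - snd s * fst t :: nat)"
  have \<Delta>: "real (\<Delta> s t) = det2 (real_point s) (real_point t)"
    if "0 \<le> det2 (real_point s) (real_point t)" for s t
  proof -
    have "real (snd s * fst t) \<le> real (fst s * snd t)"
      using that by (simp add: det2_def real_point_def)
    then have "snd s * fst t \<le> fst s * snd t" by (simp only: of_nat_le_iff)
    then show ?thesis by (simp add: \<Delta>_def det2_def real_point_def of_nat_diff)
  qed
  have "cm_monoid (polygonal_semigroup F) a b (\<Delta> a b)"
  proof
    show "a \<noteq> 0" "b \<noteq> 0" using ab(3) by (auto simp: det2_simps real_point_0)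
    have "0 < real (\<Delta> a b)" using ab(3) \<Delta>[of a b] by simp
    then show "0 < \<Delta> a b" by simp
    show "\<exists>i j. nsmul (\<Delta> a b) s = nsmul i a + nsmul j b" if "s \<in> polygonal_semigroup F" for s
    proof -
      have "real_point (nsmul (\<Delta> a b) s) = real_point (nsmul (\<Delta> s b) a + nsmul (\<Delta> a s) b)"
        using ab(3) cone'[OF that] det2_cramer[of ?A ?B "real_point s"]
        by (simp add: real_point_add real_point_nsmul \<Delta>)
      then show ?thesis unfolding real_point_eq_iff by blast
    qed
    show "\<exists>x\<in>polygonal_semigroup F. s = x + nsmul i a"
      if st: "s \<in> polygonal_semigroup F" "t \<in> polygonal_semigroup F" "s + nsmul j b = t + nsmul i a" for s t i j
    proof -
      define x where "x = real_point s - real i *\<^sub>R ?A"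
      have "real_point s + real j *\<^sub>R ?B = real_point t + real i *\<^sub>R ?A"
        using arg_cong[OF st(3), of real_point] by (simp add: real_point_add real_point_nsmul)
      then have x: "x = real_point t - real j *\<^sub>R ?B" unfolding x_def by (simp add: algebra_simps)
      have "0 \<le> det2 ?A x" using cone'(1)[OF st(1)] unfolding x_def by (simp add: det2_simps)
      moreover have "0 \<le> det2 x ?B" using cone'(2)[OF st(2)] unfolding x by (simp add: det2_simps)
      moreover have "x + real i *\<^sub>R ?A \<in> multiples F"
        using st(1) by (simp add: x_def polygonal_semigroup_iff)
      moreover have "x + real j *\<^sub>R ?B \<in> multiples F"
        using st(2) by (simp add: x polygonal_semigroup_iff)
      ultimately have xF: "x \<in> multiples F" by (rule crit)
      \<comment> \<open>The integer vector \<open>s - i a\<close> has no negative entry, so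
        subtraction of natural numbers computes it.\<close>
      then have "x \<in> quadrant" using F(2) by (auto simp: mem_multiples quadrant_def)
      then have "real (i * fst a) \<le> real (fst s)" "real (i * snd a) \<le> real (snd s)"
        by (simp_all add: x_def quadrant_def real_point_def)
      then have le: "i * fst a \<le> fst s" "i * snd a \<le> snd s" by (simp_all only: of_nat_le_iff)
      define y where "y = (fst s - i * fst a, snd s - i * snd a)"
      have "real_point y = x" using le by (simp add: y_def x_def real_point_def of_nat_diff)
      then have "y \<in> polygonal_semigroup F" using xF by (simp add: polygonal_semigroup_iff)
      moreover have "s = y + nsmul i a" using le by (simp add: y_def prod_eq_iff)
      ultimately show ?thesis by blast
    qed
  qed (use ab in auto)
  then show ?thesis by blast
qed

lemma nonneg_rat_multiple:
  assumes "v \<in> nonneg_rat_points"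
  shows "\<exists>n>0. \<exists>s. real n *\<^sub>R v = real_point s"
proof -
  have rat: "\<exists>n>0. \<exists>k. real n * x = real k" if x: "x \<in> \<rat>" "0 \<le> x" for x
  proof -
    obtain p q :: int where pq: "q > 0" "x = of_int p / of_int q"
      using x(1) by (elim Rats_cases') auto
    then have "0 \<le> p" using x(2) by (simp add: zero_le_divide_iff)
    then have "real (nat q) * x = real (nat p)" using pq by simp
    then show ?thesis using pq(1) by (intro exI[of _ "nat q"]) auto
  qed
  obtain m k n l where h: "m > 0" "real m * fst v = real k" "n > 0" "real n * snd v = real l"
    using rat[of "fst v"] rat[of "snd v"] assms by (auto simp: nonneg_rat_points_def)
  have "real (m * n) *\<^sub>R v = real_point (n * k, m * l)"
    using h by (simp add: real_point_def prod_eq_iff flip: h(2,4))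
  then show ?thesis using h by (intro exI[of _ "m * n"]) auto
qed

section \<open>Extreme points on a line through the origin, half cones and extremal rays\<close>

lemma not_extreme_between:
  assumes "(t *\<^sub>R p) extreme_point_of F" "s *\<^sub>R p \<in> F" "r *\<^sub>R p \<in> F" "p \<noteq> 0" "s < t" "t < r"
  shows False
proof -
  have "t *\<^sub>R p \<in> open_segment (s *\<^sub>R p) (r *\<^sub>R p)"
    unfolding in_segment
  proof (intro conjI exI[of _ "(t - s) / (r - s)"])
    have "(1 - (t - s) / (r - s)) * s + (t - s) / (r - s) * r = t"
    proof -
      have "(1 - (t - s) / (r - s)) * s + (t - s) / (r - s) * r = s + (t - s) / (r - s) * (r - s)"
        by (simp add: left_diff_distrib right_diff_distrib)
      then show ?thesis using assms(5,6) by simp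
    qed
    then show "t *\<^sub>R p = (1 - (t - s) / (r - s)) *\<^sub>R s *\<^sub>R p + ((t - s) / (r - s)) *\<^sub>R r *\<^sub>R p"
      by (simp flip: scaleR_add_left)
  qed (use assms in auto)
  then show False using assms(1-3) by (auto simp: extreme_point_of_def)
qed

lemma three_extreme_points_on_line:
  assumes e: "(s *\<^sub>R p) extreme_point_of F" "(t *\<^sub>R p) extreme_point_of F" "(r *\<^sub>R p) extreme_point_of F"
    and ne: "s *\<^sub>R p \<noteq> t *\<^sub>R p" "s *\<^sub>R p \<noteq> r *\<^sub>R p" "t *\<^sub>R p \<noteq> r *\<^sub>R p"
  shows False
proof -
  have F: "s *\<^sub>R p \<in> F" "t *\<^sub>R p \<in> F" "r *\<^sub>R p \<in> F" using e by (auto simp: extreme_point_of_def)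
  have "p \<noteq> 0" "s \<noteq> t" "s \<noteq> r" "t \<noteq> r" using ne by auto
  then consider "s < t" "t < r" | "s < r" "r < t" | "t < s" "s < r" | "t < r" "r < s" | "r < s" "s < t" | "r < t" "t < s"
    by linarith
  then show False
    using not_extreme_between[OF e(1)] not_extreme_between[OF e(2)] not_extreme_between[OF e(3)] F \<open>p \<noteq> 0\<close>
    by cases blast+
qed

text \<open>For \<open>x\<close> in the cone of \<open>B\<close> and \<open>C\<close>, membership in \<open>k F\<close> amounts to \<open>\<psi> x \<le> k \<le> \<phi> x\<close>, where
  \<open>\<phi>\<close> and \<open>\<psi>\<close> are the linear forms equal to \<open>1\<close> on the edges \<open>B C\<close> and \<open>B (c C)\<close>; adding \<open>i B\<close>
  to \<open>x\<close> shifts both bounds by \<open>i\<close>.\<close>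

lemma subtract_vertex:
  assumes F: "F = convex hull {A, B, C, c *\<^sub>R C}" and AB: "det2 A B \<noteq> 0"
    and C: "C = \<alpha> *\<^sub>R A + \<gamma> *\<^sub>R B" "\<alpha> > 0" "\<alpha> + \<gamma> \<le> 1" "1 \<le> c * (\<alpha> + \<gamma>)" and c: "c > 1"
    and x: "x = \<beta> *\<^sub>R C + \<delta> *\<^sub>R B" "0 \<le> \<beta>" "0 \<le> \<delta>"
    and m: "x + real i *\<^sub>R B \<in> multiples F"
  shows "x \<in> multiples F"
proof -
  obtain k f where kf: "f \<in> F" "x + real i *\<^sub>R B = real k *\<^sub>R f" using m unfolding mem_multiples by blast
  have CB: "det2 C B = \<alpha> * det2 A B" "det2 C B \<noteq> 0" using AB C by (simp_all add: det2_simps)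
  have CA: "det2 C A = - \<gamma> * det2 A B" using C(1) by (simp add: det2_simps det2_commute[of B A])
  define \<phi> where "\<phi> y = (det2 y B + det2 C y) / det2 C B" for y
  define \<psi> where "\<psi> y = (det2 y B / c + det2 C y) / det2 C B" for y
  have lin: "linear \<phi>" "linear \<psi>" "linear (\<lambda>y. - \<psi> y)"
  proof -
    show "linear \<phi>" by (rule linearI; simp add: \<phi>_def det2_simps add_divide_distrib distrib_left)
    show "linear \<psi>" by (rule linearI; simp add: \<psi>_def det2_simps add_divide_distrib distrib_left)
    then show "linear (\<lambda>y. - \<psi> y)" by (rule linear_compose_neg)
  qed
  have val: "\<phi> B = 1" "\<phi> C = 1" "\<psi> B = 1" "\<psi> C = 1 / c"
    using CB by (simp_all add: \<phi>_def \<psi>_def det2_simps)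
  \<comment> \<open>The bounds on \<open>\<alpha> + \<gamma>\<close> say that the line
    \<open>A B\<close> meets the ray of \<open>C\<close> between \<open>C\<close> and
    \<open>c C\<close>; this places \<open>A\<close> on the correct side of both edges.\<close>
  have "\<phi> A = (1 - \<gamma>) / \<alpha>" "\<psi> A = (1 / c - \<gamma>) / \<alpha>"
    unfolding \<phi>_def \<psi>_def CA CB(1) using AB C(2) c by (simp_all add: field_simps)
  moreover have "1 / c \<le> \<alpha> + \<gamma>" using C(4) c by (simp add: pos_divide_le_eq mult.commute)
  ultimately have A: "1 \<le> \<phi> A" "\<psi> A \<le> 1"
    using C(2,3) by (simp_all add: pos_le_divide_eq pos_divide_le_eq)
  have "{A, B, C, c *\<^sub>R C} \<subseteq> {y. 1 \<le> \<phi> y}" "{A, B, C, c *\<^sub>R C} \<subseteq> {y. - 1 \<le> - \<psi> y}"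
    using A val c by (simp_all add: linear_scale[OF lin(1)] linear_scale[OF lin(2)])
  then have "F \<subseteq> {y. 1 \<le> \<phi> y}" "F \<subseteq> {y. - 1 \<le> - \<psi> y}"
    unfolding F by (simp_all only: hull_minimal convex_linear_ge lin)
  then have f: "1 \<le> \<phi> f" "\<psi> f \<le> 1" using kf(1) by auto
  have "\<beta> + \<delta> + real i = real k * \<phi> f"
    using arg_cong[OF kf(2), of \<phi>] unfolding x(1) by (simp add: linear_add[OF lin(1)] linear_scale[OF lin(1)] val)
  also have "\<dots> \<ge> real k" using f(1) by (simp add: mult_le_cancel_left1)
  finally have up: "real k \<le> \<beta> + \<delta> + real i" .
  have "\<beta> / c + \<delta> + real i = real k * \<psi> f"
    using arg_cong[OF kf(2), of \<psi>] unfolding x(1) by (simp add: linear_add[OF lin(2)] linear_scale[OF lin(2)] val)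
  also have "\<dots> \<le> real k" using f(2) by (simp add: mult_le_cancel_left2)
  finally have low: "\<beta> / c + \<delta> + real i \<le> real k" .
  have "0 \<le> \<beta> / c" using x c by simp
  then have "real i \<le> real k" using low x by linarith
  then have ik: "i \<le> k" by simp
  \<comment> \<open>To show that \<open>x\<close> lies in \<open>(k - i) F\<close>, keep weight
    \<open>\<delta>\<close> on \<open>B\<close> and distribute the remaining weight
    \<open>\<mu>\<close> over \<open>C\<close> and \<open>c C\<close>. The resulting 2 by 2 system
    has a nonnegative solution precisely by the bounds \<open>up\<close> and
    \<open>low\<close>.\<close>
  define \<mu> where "\<mu> = real k - real i - \<delta>"
  have "\<beta> / c \<le> \<mu>" using low by (simp add: \<mu>_def)
  then have "\<beta> \<le> c * \<mu>" using c by (simp add: pos_divide_le_eq mult.commute)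
  moreover have "\<mu> \<le> \<beta>" using up by (simp add: \<mu>_def)
  ultimately have \<mu>: "\<mu> \<le> \<beta>" "\<beta> \<le> c * \<mu>" by simp_all
  define \<beta>\<^sub>3 where "\<beta>\<^sub>3 = (\<beta> - \<mu>) / (c - 1)"
  define \<beta>\<^sub>2 where "\<beta>\<^sub>2 = (c * \<mu> - \<beta>) / (c - 1)"
  have nn: "0 \<le> \<beta>\<^sub>2" "0 \<le> \<beta>\<^sub>3" using \<mu> c by (simp_all add: \<beta>\<^sub>2_def \<beta>\<^sub>3_def)
  have sums: "\<beta>\<^sub>2 + \<beta>\<^sub>3 = \<mu>" "\<beta>\<^sub>2 + c * \<beta>\<^sub>3 = \<beta>"
    using c by (simp_all add: \<beta>\<^sub>2_def \<beta>\<^sub>3_def divide_simps) (simp_all add: algebra_simps)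
  have V: "B \<in> F" "C \<in> F" "c *\<^sub>R C \<in> F" unfolding F by (auto intro: hull_inc)
  have cF: "convex F" unfolding F by (rule convex_convex_hull)
  obtain g where g: "g \<in> F" "\<beta>\<^sub>2 *\<^sub>R C + \<beta>\<^sub>3 *\<^sub>R (c *\<^sub>R C) = (\<beta>\<^sub>2 + \<beta>\<^sub>3) *\<^sub>R g"
    using scaled_add[OF cF V(2,3) nn] by blast
  have "0 \<le> \<beta>\<^sub>2 + \<beta>\<^sub>3" using nn by simp
  then obtain h where h: "h \<in> F" "\<delta> *\<^sub>R B + (\<beta>\<^sub>2 + \<beta>\<^sub>3) *\<^sub>R g = (\<delta> + (\<beta>\<^sub>2 + \<beta>\<^sub>3)) *\<^sub>R h"
    using scaled_add[OF cF V(1) g(1) x(3)] by blast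
  have "\<beta> *\<^sub>R C = \<beta>\<^sub>2 *\<^sub>R C + \<beta>\<^sub>3 *\<^sub>R (c *\<^sub>R C)"
    unfolding sums(2) [symmetric] by (simp add: scaleR_add_left mult.commute)
  then have "x = (\<delta> + (\<beta>\<^sub>2 + \<beta>\<^sub>3)) *\<^sub>R h" unfolding x(1) using g(2) h(2) by (simp add: add.commute)
  also have "\<delta> + (\<beta>\<^sub>2 + \<beta>\<^sub>3) = real (k - i)" unfolding sums \<mu>_def using ik by (simp add: of_nat_diff)
  finally show ?thesis using h(1) unfolding mem_multiples by blast
qed

text \<open>Moving from \<open>p\<close> in direction \<open>- u\<close> eventually leaves the
  quadrant, so it meets the frontier, that is, one of the two rays, at some
  \<open>y = p - t u\<close>. The value \<open>det2 p u\<close> equals \<open>det2 y u\<close>,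
  whose sign is known on both rays; likewise for \<open>v\<close>.\<close>

lemma frontier_ray_bounds:
  assumes K: "K \<subseteq> quadrant" and fr: "frontier K = half_line u \<union> half_line v"
    and uv: "u \<noteq> 0" "v \<noteq> 0" "0 < det2 v u" and p: "p \<in> K"
  shows "0 \<le> det2 p u" "0 \<le> det2 v p"
proof -
  have "closed quadrant"
  proof -
    have "quadrant = {x. 0 \<le> fst x} \<inter> {x. 0 \<le> snd x}" by (auto simp: quadrant_def)
    moreover have "closed \<dots>" by (intro closed_Int closed_Collect_le continuous_intros)
    ultimately show ?thesis by simp
  qed
  then have "frontier K \<subseteq> quadrant" using K by (simp add: frontier_def closure_minimal subset_iff) (meson K closure_minimal subset_iff)
  moreover have "u \<in> half_line u" "v \<in> half_line v" by (auto simp: half_line_def intro!: exI[of _ 1])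
  ultimately have Q: "u \<in> quadrant" "v \<in> quadrant" using fr by auto
  have crossing: "\<exists>y\<in>half_line u \<union> half_line v. \<exists>t. y = p - t *\<^sub>R w" if w: "w \<in> quadrant" "w \<noteq> 0" for w
  proof -
    \<comment> \<open>Makes the coordinate sum of \<open>p - t w\<close> equal to -1.\<close>
    define t where "t = (fst p + snd p + 1) / (fst w + snd w)"
    have "fst w + snd w > 0" using w by (auto simp: quadrant_def prod_eq_iff add_nonneg_eq_0_iff less_le)
    then have "t * (fst w + snd w) = fst p + snd p + 1" by (simp add: t_def)
    then have "fst (p - t *\<^sub>R w) + snd (p - t *\<^sub>R w) = - 1" by (simp add: distrib_left)
    then have out: "p - t *\<^sub>R w \<notin> K" using K by (auto simp: quadrant_def)
    have "closed_segment p (p - t *\<^sub>R w) \<inter> frontier K \<noteq> {}"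
      using p out by (intro connected_Int_frontier) auto
    then obtain y r where "y \<in> frontier K" "y = (1 - r) *\<^sub>R p + r *\<^sub>R (p - t *\<^sub>R w)"
      by (auto simp: in_segment)
    then show ?thesis unfolding fr by (intro bexI[of _ y] exI[of _ "r * t"]) (auto simp: algebra_simps)
  qed
  show "0 \<le> det2 p u"
  proof -
    obtain y t where y: "y \<in> half_line u \<union> half_line v" "y = p - t *\<^sub>R u" using crossing[OF Q(1) uv(1)] by blast
    have "0 \<le> det2 y u" using y(1) uv(3) by (auto simp: half_line_def det2_simps)
    then show ?thesis by (simp add: y(2) det2_simps)
  qed
  show "0 \<le> det2 v p"
  proof -
    obtain y t where y: "y \<in> half_line u \<union> half_line v" "y = p - t *\<^sub>R v" using crossing[OF Q(2) uv(2)] by blast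
    have "0 \<le> det2 v y" using y(1) uv(3) by (auto simp: half_line_def det2_simps)
    then show ?thesis by (simp add: y(2) det2_simps)
  qed
qed


text \<open>The two generators come from the nonzero vertices of least and greatest slope. Since
  \<open>F\<close> contains the origin, \<open>r F\<close> increases with \<open>r\<close>, so the
  multiples of \<open>F\<close> fill the whole cone between these vertices.\<close>

lemma cm_monoid_pointed:
  assumes poly: "convex_polygon_with_vertices F V" and V: "V \<subseteq> nonneg_rat_points" and zero: "0 \<in> F"
  shows "\<exists>a b D. cm_monoid (polygonal_semigroup F) a b D"
proof -
  have F: "F = convex hull V" "finite V" "3 \<le> card V" and ext: "{x. x extreme_point_of F} = V"
    using poly by (auto simp: convex_polygon_with_vertices_def)
  have cF: "convex F" unfolding F by (rule convex_convex_hull)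
  have VQ: "V \<subseteq> quadrant" using V by (auto simp: nonneg_rat_points_def quadrant_def)
  then have FQ: "F \<subseteq> quadrant" unfolding F by (simp add: hull_minimal convex_quadrant)
  have VF: "V \<subseteq> F" unfolding F by (rule hull_subset)
  define W where "W = V - {0}"
  \<comment> \<open>An increasing function of the usual slope that stays finite for vertical
    directions.\<close>
  define slope where "slope v = snd v / (fst v + snd v)" for v :: "real \<times> real"
  have pos: "0 < fst v + snd v" if "v \<in> W" for v
  proof -
    have "0 \<le> fst v" "0 \<le> snd v" "v \<noteq> 0" using that VQ by (auto simp: W_def quadrant_def)
    then show ?thesis by (auto simp: prod_eq_iff add_nonneg_eq_0_iff less_le)
  qed
  have slope_le: "slope v \<le> slope w \<longleftrightarrow> 0 \<le> det2 v w" if "v \<in> W" "w \<in> W" for v w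
    using pos[OF that(1)] pos[OF that(2)] by (simp add: slope_def det2_def divide_simps) (simp add: algebra_simps)
  have "0 < card W" unfolding W_def using F(3) diff_card_le_card_Diff[of "{0}" V] by simp
  then have "W \<noteq> {}" "finite W" by (simp_all add: card_gt_0_iff)
  then have "Min (slope ` W) \<in> slope ` W" "Max (slope ` W) \<in> slope ` W" by (simp_all add: Min_in Max_in)
  then obtain p q where pq: "p \<in> W" "slope p = Min (slope ` W)" "q \<in> W" "slope q = Max (slope ` W)"
    by (metis imageE)
  have det: "0 \<le> det2 p v" "0 \<le> det2 v q" if "v \<in> W" for v
    using slope_le[OF pq(1) that] slope_le[OF that pq(3)] that pq \<open>finite W\<close> by simp_all
  have det': "0 \<le> det2 p v" "0 \<le> det2 v q" if "v \<in> V" for v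
    using det[of v] that by (cases "v = 0"; simp add: W_def det2_simps)+
  have F_det: "0 \<le> det2 p x" "0 \<le> det2 x q" if "x \<in> F" for x
  proof -
    have "V \<subseteq> {x. 0 \<le> det2 p x}" "V \<subseteq> {x. 0 \<le> det2 x q}" using det' by auto
    then have "F \<subseteq> {x. 0 \<le> det2 p x}" "F \<subseteq> {x. 0 \<le> det2 x q}"
      unfolding F by (simp_all only: hull_minimal convex_linear_ge linear_det2)
    then show "0 \<le> det2 p x" "0 \<le> det2 x q" using that by auto
  qed
  have p_nz: "p \<noteq> 0" using pq(1) by (simp add: W_def)
  \<comment> \<open>If the extreme slopes agreed, all vertices would lie on one line through the
    origin, which cannot carry three extreme points.\<close>
  have pq_pos: "0 < det2 p q"
  proof (rule ccontr)
    assume "\<not> 0 < det2 p q"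
    then have eq: "slope p = slope q" using det(1)[OF pq(3)] slope_le[OF pq(3,1)] slope_le[OF pq(1,3)]
      by (simp add: det2_commute[of q p])
    have on_line: "\<exists>t. v = t *\<^sub>R p" if v: "v \<in> V" for v
    proof (cases "v = 0")
      case True
      then show ?thesis by (intro exI[of _ 0]) simp
    next
      case False
      then have vW: "v \<in> W" using v by (simp add: W_def)
      then have "slope p \<le> slope v" "slope v \<le> slope q" using pq \<open>finite W\<close> by simp_all
      then have "0 \<le> det2 p v" "0 \<le> det2 v p" using slope_le[OF pq(1) vW] slope_le[OF vW pq(1)] eq by auto
      then have d0: "det2 p v = 0" using det2_commute[of p v] by simp
      have "(fst p + snd p) *\<^sub>R v = (fst v + snd v) *\<^sub>R p"
        using d0 by (simp add: det2_def prod_eq_iff algebra_simps)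
      then have "(1 / (fst p + snd p)) *\<^sub>R (fst p + snd p) *\<^sub>R v =
          (1 / (fst p + snd p)) *\<^sub>R (fst v + snd v) *\<^sub>R p"
        by (rule arg_cong)
      then have "v = (1 / (fst p + snd p) * (fst v + snd v)) *\<^sub>R p"
        using pos[OF pq(1)] by simp
      then show ?thesis by blast
    qed
    obtain T where T: "T \<subseteq> V" "card T = 3" using F(3) by (rule obtain_subset_with_card_n)
    then obtain x y z where xyz: "x \<in> V" "y \<in> V" "z \<in> V" "x \<noteq> y" "x \<noteq> z" "y \<noteq> z"
      unfolding card_3_iff by blast
    obtain s t r where str: "x = s *\<^sub>R p" "y = t *\<^sub>R p" "z = r *\<^sub>R p" using on_line xyz by meson
    have "x extreme_point_of F" "y extreme_point_of F" "z extreme_point_of F" using ext xyz by auto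
    then show False using xyz three_extreme_points_on_line[of s p F t r] unfolding str by blast
  qed
  have "p \<in> nonneg_rat_points" "q \<in> nonneg_rat_points" using pq V by (auto simp: W_def)
  then obtain m a n b where ab: "m > 0" "real m *\<^sub>R p = real_point a" "n > 0" "real n *\<^sub>R q = real_point b"
    using nonneg_rat_multiple by metis
  have pF: "p \<in> F" "q \<in> F" using pq VF by (auto simp: W_def)
  have "\<exists>D. cm_monoid (polygonal_semigroup F) a b D"
  proof (rule cm_monoid_polygonal[OF cF FQ])
    show "a \<in> polygonal_semigroup F" "b \<in> polygonal_semigroup F"
      unfolding polygonal_semigroup_iff mem_multiples using ab(2,4) pF by metis+
    show "0 < det2 (real_point a) (real_point b)"
      unfolding ab(2,4) [symmetric] using ab(1,3) pq_pos by (simp add: det2_simps)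
    show "0 \<le> det2 (real_point a) x \<and> 0 \<le> det2 x (real_point b)" if "x \<in> F" for x
      unfolding ab(2,4) [symmetric] using F_det[OF that] by (simp add: det2_simps)
    fix x :: "real \<times> real"
    assume "0 \<le> det2 (real_point a) x" "0 \<le> det2 x (real_point b)"
    then have x: "0 \<le> det2 p x" "0 \<le> det2 x q"
      unfolding ab(2,4) [symmetric] using ab(1,3) by (simp_all add: det2_simps zero_le_mult_iff)
    \<comment> \<open>\<open>x\<close> lies in \<open>r F\<close> for a real \<open>r\<close>;
      adding a multiple of the origin, a point of \<open>F\<close>, raises the factor to an
      integer.\<close>
    define r where "r = det2 x q / det2 p q + det2 p x / det2 p q"
    have nn: "0 \<le> det2 x q / det2 p q" "0 \<le> det2 p x / det2 p q" using x pq_pos by simp_all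
    obtain h where h: "h \<in> F" "x = r *\<^sub>R h"
      using scaled_add[OF cF pF nn] det2_decompose[of p q x] pq_pos by (auto simp: r_def)
    obtain k :: nat where k: "r \<le> real k" using real_arch_simple by blast
    have "0 \<le> r" using nn by (simp add: r_def)
    then obtain g where "g \<in> F" "r *\<^sub>R h + (real k - r) *\<^sub>R 0 = (r + (real k - r)) *\<^sub>R g"
      using scaled_add[OF cF h(1) zero] k by (metis diff_ge_0_iff_ge)
    then have "g \<in> F" "x = real k *\<^sub>R g" using h(2) by simp_all
    then show "x \<in> multiples F" unfolding mem_multiples by blast
  qed
  then show ?thesis by blast
qed

text \<open>The ray of \<open>C\<close> lies strictly inside the cone, as otherwise
  \<open>C\<close>, \<open>c C\<close> and one of \<open>A\<close>, \<open>B\<close> would be three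
  extreme points on a line. It divides the cone into two halves, and \<open>subtract_vertex\<close>
  is applied in the half containing \<open>x\<close> with the vertex on its outer ray.\<close>

lemma cm_monoid_aligned:
  assumes F: "F = convex hull {A, B, C, c *\<^sub>R C}" and cpos: "c > 1" and FQ: "F \<subseteq> quadrant"
    and ext: "A extreme_point_of F" "B extreme_point_of F" "C extreme_point_of F" "(c *\<^sub>R C) extreme_point_of F"
    and ne: "A \<noteq> C" "A \<noteq> c *\<^sub>R C" "B \<noteq> C" "B \<noteq> c *\<^sub>R C" "C \<noteq> 0"
    and AB: "0 < det2 A B" and cone: "0 \<le> det2 A C" "0 \<le> det2 C B"
    and ab: "A = real_point a" "B = real_point b" "a \<in> polygonal_semigroup F" "b \<in> polygonal_semigroup F"
  shows "\<exists>D. cm_monoid (polygonal_semigroup F) a b D"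
proof -
  have cF: "convex F" unfolding F by (rule convex_convex_hull)
  have V: "A \<in> F" "B \<in> F" "C \<in> F" "c *\<^sub>R C \<in> F" unfolding F by (auto intro: hull_inc)
  have C_cC: "C \<noteq> c *\<^sub>R C"
  proof
    assume "C = c *\<^sub>R C"
    then have "(c - 1) *\<^sub>R C = 0" by (simp add: scaleR_left_diff_distrib)
    then show False using cpos ne(5) by simp
  qed
  define \<alpha> where "\<alpha> = det2 C B / det2 A B"
  define \<gamma> where "\<gamma> = det2 A C / det2 A B"
  have C: "C = \<alpha> *\<^sub>R A + \<gamma> *\<^sub>R B" unfolding \<alpha>_def \<gamma>_def by (rule det2_decompose) (use AB in simp)
  have nn: "0 \<le> \<alpha>" "0 \<le> \<gamma>" using AB cone by (simp_all add: \<alpha>_def \<gamma>_def)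
  have "\<alpha> \<noteq> 0"
  proof
    assume "\<alpha> = 0"
    then have CB: "C = \<gamma> *\<^sub>R B" "c *\<^sub>R C = (c * \<gamma>) *\<^sub>R B" using C by simp_all
    show False
      using three_extreme_points_on_line[of 1 B F \<gamma> "c * \<gamma>"] ext ne C_cC CB by simp
  qed
  moreover have "\<gamma> \<noteq> 0"
  proof
    assume "\<gamma> = 0"
    then have CA: "C = \<alpha> *\<^sub>R A" "c *\<^sub>R C = (c * \<alpha>) *\<^sub>R A" using C by simp_all
    show False
      using three_extreme_points_on_line[of 1 A F \<alpha> "c * \<alpha>"] ext ne C_cC CA by simp
  qed
  ultimately have pos: "0 < \<alpha>" "0 < \<gamma>" using nn by simp_all
  \<comment> \<open>\<open>\<zeta> C\<close> is the point where the segment from \<open>A\<close> to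
    \<open>B\<close> crosses the ray of \<open>C\<close>. It belongs to \<open>F\<close>, so
    extremality of \<open>C\<close> and of \<open>c C\<close> forces
    \<open>1 \<le> \<zeta> \<le> c\<close>.\<close>
  define \<zeta> where "\<zeta> = 1 / (\<alpha> + \<gamma>)"
  obtain Z where Z: "Z \<in> F" "C = (\<alpha> + \<gamma>) *\<^sub>R Z" using scaled_add[OF cF V(1,2) nn] C by auto
  have "Z = \<zeta> *\<^sub>R C" unfolding Z(2) \<zeta>_def using pos by simp
  then have ZF: "\<zeta> *\<^sub>R C \<in> F" using Z(1) by simp
  have "1 \<le> \<zeta>"
    using not_extreme_between[of 1 C F \<zeta> c] ext V ZF ne cpos by force
  then have le: "\<alpha> + \<gamma> \<le> 1" using pos by (simp add: \<zeta>_def pos_le_divide_eq)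
  have "\<zeta> \<le> c"
    using not_extreme_between[of c C F 1 \<zeta>] ext V ZF ne cpos by force
  then have ge: "1 \<le> c * (\<alpha> + \<gamma>)" using pos by (simp add: \<zeta>_def pos_divide_le_eq)
  have F': "F = convex hull {B, A, C, c *\<^sub>R C}" unfolding F by (simp add: insert_commute)
  show ?thesis
  proof (rule cm_monoid_polygonal[OF cF FQ ab(3,4)])
    show "0 < det2 (real_point a) (real_point b)" using AB ab by simp
    have "{A, B, C, c *\<^sub>R C} \<subseteq> {x. 0 \<le> det2 A x}" "{A, B, C, c *\<^sub>R C} \<subseteq> {x. 0 \<le> det2 x B}"
      using AB cone cpos by (auto simp: det2_simps)
    then have "F \<subseteq> {x. 0 \<le> det2 A x}" "F \<subseteq> {x. 0 \<le> det2 x B}"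
      unfolding F by (simp_all only: hull_minimal convex_linear_ge linear_det2)
    then show "0 \<le> det2 (real_point a) x \<and> 0 \<le> det2 x (real_point b)" if "x \<in> F" for x
      using that ab by auto
    fix x :: "real \<times> real" and i j
    assume x: "0 \<le> det2 (real_point a) x" "0 \<le> det2 x (real_point b)"
      and xm: "x + real i *\<^sub>R real_point a \<in> multiples F" "x + real j *\<^sub>R real_point b \<in> multiples F"
    define p where "p = det2 x B / det2 A B"
    define q where "q = det2 A x / det2 A B"
    have pq: "x = p *\<^sub>R A + q *\<^sub>R B" unfolding p_def q_def by (rule det2_decompose) (use AB in simp)
    have pq_nn: "0 \<le> p" "0 \<le> q" using AB x ab by (simp_all add: p_def q_def)
    show "x \<in> multiples F"
    \<comment> \<open>The inequality says that \<open>x\<close> lies between the rays of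
      \<open>C\<close> and \<open>B\<close>.\<close>
    proof (cases "p * \<gamma> \<le> q * \<alpha>")
      case True
      have x_eq: "x = (p / \<alpha>) *\<^sub>R C + (q - p * \<gamma> / \<alpha>) *\<^sub>R B"
        unfolding pq C using pos by (simp add: algebra_simps)
      have "0 \<le> p / \<alpha>" "0 \<le> q - p * \<gamma> / \<alpha>"
        using True pos pq_nn by (simp_all add: pos_divide_le_eq)
      moreover have "det2 A B \<noteq> 0" "x + real j *\<^sub>R B \<in> multiples F" using AB xm(2) ab by simp_all
      ultimately show ?thesis using subtract_vertex[OF F _ C pos(1) le ge cpos x_eq] by blast
    next
      case False
      have x_eq: "x = (q / \<gamma>) *\<^sub>R C + (p - q * \<alpha> / \<gamma>) *\<^sub>R A"
        unfolding pq C using pos by (simp add: algebra_simps)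
      have "0 \<le> q / \<gamma>" "0 \<le> p - q * \<alpha> / \<gamma>"
        using False pos pq_nn by (simp_all add: pos_divide_le_eq)
      moreover have "det2 B A \<noteq> 0" "x + real i *\<^sub>R A \<in> multiples F"
        using AB xm(1) ab det2_commute[of B A] by simp_all
      moreover have "C = \<gamma> *\<^sub>R B + \<alpha> *\<^sub>R A" "\<gamma> + \<alpha> \<le> 1" "1 \<le> c * (\<gamma> + \<alpha>)"
        using C le ge by (simp_all add: add.commute)
      ultimately show ?thesis using subtract_vertex[OF F' _ _ pos(2) _ _ cpos x_eq] by blast
    qed
  qed
qed

text \<open>The extremal rays are defined by lattice points of the rational cone; clearing
  denominators moves a vertex into that set along its own ray.\<close>

lemma rat_vertex_in_cone:
  assumes "P \<in> F" "P \<in> nonneg_rat_points"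
  shows "\<exists>n>0. real n *\<^sub>R P \<in> rat_cone F \<inter> Set.range real_point"
proof -
  obtain n s where n: "n > 0" "real n *\<^sub>R P = real_point s" using nonneg_rat_multiple[OF assms(2)] by blast
  have "real n *\<^sub>R P \<in> rat_cone F"
    unfolding rat_cone_def using assms(1)
    by (intro CollectI exI[of _ "1::nat"] exI[of _ "\<lambda>_. real n"] exI[of _ "\<lambda>_. P"]) simp
  then show ?thesis using n by auto
qed

theorem corollary9:
  fixes F :: "(real \<times> real) set" and P\<^sub>1 P\<^sub>2 P\<^sub>3 P\<^sub>4 :: "real \<times> real"
    and \<tau>\<^sub>1 \<tau>\<^sub>2 :: "(real \<times> real) set" and \<P> :: "(nat \<times> nat) set"
  assumes "card {P\<^sub>1, P\<^sub>2, P\<^sub>3, P\<^sub>4} = 4"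
    and "convex_polygon_with_vertices F {P\<^sub>1, P\<^sub>2, P\<^sub>3, P\<^sub>4}"
    and "{P\<^sub>1, P\<^sub>2, P\<^sub>3, P\<^sub>4} \<subseteq> nonneg_rat_points"
    and "\<P> = polygonal_semigroup F"
    and "extremal_rays (rat_cone F \<inter> range real_point) \<tau>\<^sub>1 \<tau>\<^sub>2"
    and "P\<^sub>1 \<in> real_point ` \<P> \<inter> \<tau>\<^sub>1"
    and "P\<^sub>4 \<in> real_point ` \<P> \<inter> \<tau>\<^sub>2"
    and "collinear {0, P\<^sub>2, P\<^sub>3}"
  shows "buchsbaum_semigroup TYPE('k::field) \<P>"
proof -
  let ?V = "{P\<^sub>1, P\<^sub>2, P\<^sub>3, P\<^sub>4}"
  have "\<exists>a b D. cm_monoid \<P> a b D"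
  proof (cases "0 \<in> F")
    case True
    then show ?thesis using cm_monoid_pointed[OF assms(2,3)] assms(4) by blast
  next
    case False
    have F: "F = convex hull ?V" and ext: "\<And>v. v \<in> ?V \<Longrightarrow> v extreme_point_of F"
      using assms(2) by (auto simp: convex_polygon_with_vertices_def)
    have VF: "?V \<subseteq> F" unfolding F by (rule hull_subset)
    have VQ: "?V \<subseteq> quadrant" using assms(3) by (auto simp: nonneg_rat_points_def quadrant_def)
    then have FQ: "F \<subseteq> quadrant" unfolding F by (intro hull_minimal convex_quadrant)
    have dist: "P\<^sub>1 \<noteq> P\<^sub>2" "P\<^sub>1 \<noteq> P\<^sub>3" "P\<^sub>4 \<noteq> P\<^sub>2" "P\<^sub>4 \<noteq> P\<^sub>3" "P\<^sub>2 \<noteq> P\<^sub>3"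
      using assms(1) by (auto simp: card_insert_if split: if_splits)
    have nz: "v \<noteq> 0" if "v \<in> ?V" for v using that VF False by auto
    obtain u v where uv: "u \<noteq> 0" "v \<noteq> 0" "\<tau>\<^sub>1 = half_line u" "\<tau>\<^sub>2 = half_line v"
      "snd v * fst u < snd u * fst v"
      "frontier (convex_cone hull (rat_cone F \<inter> Set.range real_point)) = half_line u \<union> half_line v"
      using assms(5) unfolding extremal_rays_def by blast
    have vu: "0 < det2 v u" using uv(5) by (simp add: det2_def algebra_simps)
    let ?K = "convex_cone hull (rat_cone F \<inter> Set.range real_point)"
    have "convex_cone quadrant"
      unfolding convex_cone_def conic_def using convex_quadrant
      by (auto simp: quadrant_def)
    moreover have "rat_cone F \<inter> Set.range real_point \<subseteq> quadrant" by (auto simp: quadrant_def real_point_def)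
    ultimately have KQ: "?K \<subseteq> quadrant" by (intro hull_minimal)
    have cone: "0 \<le> det2 w u" "0 \<le> det2 v w" if w: "w \<in> ?V" for w
    proof -
      obtain n :: nat where n: "n > 0" "real n *\<^sub>R w \<in> rat_cone F \<inter> Set.range real_point"
        using rat_vertex_in_cone[of w F] w VF assms(3) by blast
      then have "real n *\<^sub>R w \<in> ?K" by (intro hull_inc)
      then have "0 \<le> det2 (real n *\<^sub>R w) u" "0 \<le> det2 v (real n *\<^sub>R w)"
        by (rule frontier_ray_bounds(1)[OF KQ uv(6,1,2) vu], rule frontier_ray_bounds(2)[OF KQ uv(6,1,2) vu])
      then show "0 \<le> det2 w u" "0 \<le> det2 v w" using n(1) by (simp_all add: det2_simps zero_le_mult_iff)
    qed
    obtain t\<^sub>1 t\<^sub>4 where t: "0 \<le> t\<^sub>1" "P\<^sub>1 = t\<^sub>1 *\<^sub>R u" "0 \<le> t\<^sub>4" "P\<^sub>4 = t\<^sub>4 *\<^sub>R v"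
      using assms(6,7) unfolding uv(3,4) half_line_def by blast
    then have tpos: "0 < t\<^sub>1" "0 < t\<^sub>4" using nz[of P\<^sub>1] nz[of P\<^sub>4] by (auto simp: less_le)
    have det41: "0 < det2 P\<^sub>4 P\<^sub>1" unfolding t using tpos vu by (simp add: det2_simps)
    have cone': "0 \<le> det2 P\<^sub>4 w" "0 \<le> det2 w P\<^sub>1" if "w \<in> ?V" for w
      unfolding t(2,4) using cone[OF that] tpos by (simp_all add: det2_simps)
    obtain b a where ab: "P\<^sub>1 = real_point b" "b \<in> polygonal_semigroup F" "P\<^sub>4 = real_point a" "a \<in> polygonal_semigroup F"
      using assms(4,6,7) by blast
    \<comment> \<open>Either of \<open>P\<^sub>2\<close>, \<open>P\<^sub>3\<close> may be the one
      nearer to the origin; \<open>C\<close> stands for the nearer one.\<close>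
    have main: "\<exists>D. cm_monoid (polygonal_semigroup F) a b D"
      if C: "{C, c *\<^sub>R C} = {P\<^sub>2, P\<^sub>3}" "1 < c" for C c
    proof -
      have V: "?V = {P\<^sub>4, P\<^sub>1, C, c *\<^sub>R C}" using C(1) by auto
      have mem: "C \<in> {P\<^sub>2, P\<^sub>3}" "c *\<^sub>R C \<in> {P\<^sub>2, P\<^sub>3}" using C(1) by auto
      then have mem': "C \<in> ?V" "c *\<^sub>R C \<in> ?V" by auto
      have ne: "P\<^sub>4 \<noteq> C" "P\<^sub>4 \<noteq> c *\<^sub>R C" "P\<^sub>1 \<noteq> C" "P\<^sub>1 \<noteq> c *\<^sub>R C" using mem dist by auto
      have FV: "F = convex hull {P\<^sub>4, P\<^sub>1, C, c *\<^sub>R C}" unfolding F V ..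
      have "P\<^sub>4 extreme_point_of F" "P\<^sub>1 extreme_point_of F" by (simp_all add: ext)
      then show ?thesis
        by (rule cm_monoid_aligned[OF FV C(2) FQ _ _ ext[OF mem'(1)] ext[OF mem'(2)] ne nz[OF mem'(1)]
          det41 cone'(1)[OF mem'(1)] cone'(2)[OF mem'(1)] ab(3,1,4,2)])
    qed
    obtain c where c: "P\<^sub>3 = c *\<^sub>R P\<^sub>2"
      using assms(8) nz[of P\<^sub>2] nz[of P\<^sub>3] unfolding collinear_lemma by auto
    have "c \<noteq> 1" using c dist by auto
    \<comment> \<open>Both points lie in the quadrant, so a factor that is not positive would make
      \<open>P\<^sub>3\<close> the origin.\<close>
    have "0 < c"
    proof (rule ccontr)
      assume "\<not> 0 < c"
      then have "c * fst P\<^sub>2 \<le> 0" "c * snd P\<^sub>2 \<le> 0"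
        using VQ by (auto simp: quadrant_def mult_le_0_iff)
      then have "P\<^sub>3 = 0" using c VQ by (auto simp: quadrant_def prod_eq_iff)
      then show False using nz by blast
    qed
    have "\<exists>D. cm_monoid (polygonal_semigroup F) a b D"
    proof (cases "1 < c")
      case True
      then show ?thesis using main[of P\<^sub>2 c] c by simp
    next
      case False
      then have "1 < inverse c" using \<open>0 < c\<close> \<open>c \<noteq> 1\<close> by (simp add: one_less_inverse_iff)
      moreover have "P\<^sub>2 = inverse c *\<^sub>R P\<^sub>3" using c \<open>0 < c\<close> by simp
      ultimately show ?thesis using main[of P\<^sub>3 "inverse c"] by (metis insert_commute)
    qed
    then show ?thesis using assms(4) by blast
  qed
  then show ?thesis using cm_monoid.buchsbaum_semigroup_S by blast
qed

end
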